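(* Let $p>1$ and let $\mu$ be a locally finite Borel measure on $\mathbb{R}$ with Lebesgue decomposition $\mu=\mu_a+\mu_s$, where $\mu_a=f_a\mathcal{L}^1$ with $f_a$ a nonnegative real-valued Borel function on $\mathbb{R}$, and let $N\subset\mathbb{R}$ be a Lebesgue null set on which $\mu_s$ is concentrated. Let $$\mathcal{N}_p=\left\{x\in\mathbb{R} : f_a^{1/(1-p)}\text{ is Lebesgue integrable on a neighbourhood of }x\right\}.$$ Let $f\colon\mathbb{R}\to\mathbb{R}$ be Lipschitz and define, for $\mu$-almost every $x$, $$|df|_{p,\mu}(x)=\begin{cases}|f'(x)| & \text{if }x\in\mathcal{N}_p\setminus N,\\ 0&\text{otherwise.}\end{cases}$$ Then $|\nabla f|_{p,\mu}(x)=|df|_{p,\mu}(x)$ for $\mu$-almost every $x$, where $|\nabla f|_{p,\mu}$ is the $p$-weak gradient of $f$ on $(\mathbb{R},|\cdot|,\mu)$.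
   Context: $\mathcal{L}^1$ is Lebesgue measure; $\mu_a\ll\mathcal{L}^1$ and $\mu_s\perp\mathcal{L}^1$. Convention: $f_a^{1/(1-p)}=+\infty$ where $f_a=0$. (The derivative $f'$ exists $\mathcal{L}^1$-a.e., hence $\mu$-a.e. in the complement of $N$, so $|df|_{p,\mu}$ is defined $\mu$-a.e.) A curve in $\mathbb{R}$ is a continuous map $\gamma\colon I\to\mathbb{R}$ with $I$ a closed bounded interval, with end points $a_\gamma,b_\gamma$ (the values of $\gamma$ at the ends of $I$); only absolutely continuous curves are considered, $|\dot\gamma|$ is the metric speed (the absolute value of the derivative), and $\int_\gamma g\,ds=\int_I g(\gamma(s))|\dot\gamma|(s)\,ds$ for Borel $g$. For a family $\Gamma$ of absolutely continuous curves, $\mathrm{Mod}_{p,\mu}(\Gamma)=\inf\int_{\mathbb{R}}g^p\,d\mu$, the infimum being over Borel $g\colon\mathbb{R}\to[0,\infty]$ with $\int_\gamma g\,ds\ge1$ for all $\gamma\in\Gamma$. A property holds for $p$-a.e. curve if the set of absolutely continuous curves for which it fails has $\mathrm{Mod}_{p,\mu}$ zero. A Borel function $g\colon\mathbb{R}\to[0,\infty]$ is a $p$-upper gradient of $f$ if $|f(b_\gamma)-f(a_\gamma)|\le\int_\gamma g\,ds$ for $p$-a.e. curve $\gamma$. The $p$-weak gradient (minimal $p$-upper gradient) $|\nabla f|_{p,\mu}$ is the $p$-upper gradient of $f$ characterized, up to $\mu$-negligible sets, by $|\nabla f|_{p,\mu}\le g$ $\mu$-a.e. for every $p$-upper gradient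 $g$ of $f$.
   Formalization: The p-weak gradient is taken to be the minimal one among p-upper gradients that are locally p-integrable with respect to μ; among all Borel p-upper gradients a least one need not exist (e.g. Lebesgue measure and f the identity). *)

theory Defs
  imports "HOL-Analysis.Analysis"
begin

definition locally_finite_measure :: "real measure \<Rightarrow> bool" where
  "locally_finite_measure M \<longleftrightarrow> (\<forall>x. \<exists>U. open U \<and> x \<in> U \<and> emeasure M U < \<infinity>)"

text \<open>Real powers of extended nonnegative numbers. Only used with exponent \<open>p > 0\<close>, so that
  the value at \<open>0\<close> is \<open>0\<close> and the value at \<open>\<infinity>\<close> is \<open>\<infinity>\<close>.\<close>

definition epowr :: "ennreal \<Rightarrow> real \<Rightarrow> ennreal" where
  "epowr x p = (if x = \<infinity> then \<infinity> else ennreal (enn2real x powr p))"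

definition absolutely_continuous_curve_on :: "real \<Rightarrow> real \<Rightarrow> (real \<Rightarrow> real) \<Rightarrow> bool" where
  "absolutely_continuous_curve_on a b \<gamma> \<longleftrightarrow>
     (\<forall>\<epsilon>>0. \<exists>\<delta>>0. \<forall>(n::nat) u v.
        (\<forall>i<n. a \<le> u i \<and> u i \<le> v i \<and> v i \<le> b) \<and>
        disjoint_family_on (\<lambda>i. {u i<..<v i}) {..<n} \<and>
        (\<Sum>i<n. v i - u i) < \<delta> \<longrightarrow>
        (\<Sum>i<n. \<bar>\<gamma> (v i) - \<gamma> (u i)\<bar>) < \<epsilon>)"

text \<open>A triple \<open>(a, b, \<gamma>)\<close> represents the curve \<open>\<gamma>\<close> restricted to \<open>{a..b}\<close>. The values of \<open>\<gamma>\<close>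
  outside \<open>{a..b}\<close> play no role.\<close>

type_synonym curve = "real \<times> real \<times> (real \<Rightarrow> real)"

definition ac_curves :: "curve set" where
  "ac_curves = {(a, b, \<gamma>). a \<le> b \<and> absolutely_continuous_curve_on a b \<gamma>}"

text \<open>\<open>\<gamma>\<close> is differentiable almost everywhere on \<open>{a..b}\<close>, so the unspecified values of \<open>deriv\<close> at
  the remaining points, and its values at the end points, do not affect the integral.\<close>

fun curve_integral :: "(real \<Rightarrow> ennreal) \<Rightarrow> curve \<Rightarrow> ennreal" where
  "curve_integral g (a, b, \<gamma>) =
     (\<integral>\<^sup>+s\<in>{a..b}. (g (\<gamma> s) * ennreal \<bar>deriv \<gamma> s\<bar>) \<partial>lborel)"

definition Modulus :: "real \<Rightarrow> real measure \<Rightarrow> curve set \<Rightarrow> ennreal" where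
  "Modulus p \<mu> \<Gamma> =
     (INF g \<in> {g \<in> borel_measurable borel. \<forall>c\<in>\<Gamma>. 1 \<le> curve_integral g c}.
        \<integral>\<^sup>+x. epowr (g x) p \<partial>\<mu>)"

definition AE_curve :: "real \<Rightarrow> real measure \<Rightarrow> (curve \<Rightarrow> bool) \<Rightarrow> bool" where
  "AE_curve p \<mu> P \<longleftrightarrow> Modulus p \<mu> {c \<in> ac_curves. \<not> P c} = 0"

definition p_upper_gradient ::
    "real \<Rightarrow> real measure \<Rightarrow> (real \<Rightarrow> real) \<Rightarrow> (real \<Rightarrow> ennreal) \<Rightarrow> bool" where
  "p_upper_gradient p \<mu> f g \<longleftrightarrow>
     g \<in> borel_measurable borel \<and>
     AE_curve p \<mu> (\<lambda>(a, b, \<gamma>). ennreal \<bar>f (\<gamma> b) - f (\<gamma> a)\<bar> \<le> curve_integral g (a, b, \<gamma>))"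

definition locally_p_integrable :: "real \<Rightarrow> real measure \<Rightarrow> (real \<Rightarrow> ennreal) \<Rightarrow> bool" where
  "locally_p_integrable p \<mu> g \<longleftrightarrow>
     (\<forall>x. \<exists>U. open U \<and> x \<in> U \<and> (\<integral>\<^sup>+y\<in>U. epowr (g y) p \<partial>\<mu>) < \<infinity>)"

text \<open>Minimality is understood, as usual, within the locally \<open>p\<close>-integrable \<open>p\<close>-upper gradients.
  Among all Borel \<open>p\<close>-upper gradients a least one need not exist: let \<open>\<mu>\<close> be Lebesgue measure, let
  \<open>f\<close> be the identity and let \<open>K\<close> be a compact nowhere dense set of positive measure. The function
  that vanishes on \<open>K\<close> and equals \<open>1 + 1 / dist(x, K)\<close> off \<open>K\<close> is an upper gradient of \<open>f\<close>, since
  its integral over any nondegenerate interval meeting \<open>K\<close> is infinite. As such sets \<open>K\<close> exhaust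
  the line up to a null set, a least upper gradient would vanish almost everywhere.\<close>

definition p_weak_gradient ::
    "real \<Rightarrow> real measure \<Rightarrow> (real \<Rightarrow> real) \<Rightarrow> (real \<Rightarrow> ennreal) \<Rightarrow> bool" where
  "p_weak_gradient p \<mu> f G \<longleftrightarrow>
     p_upper_gradient p \<mu> f G \<and> locally_p_integrable p \<mu> G \<and>
     (\<forall>g. p_upper_gradient p \<mu> f g \<and> locally_p_integrable p \<mu> g \<longrightarrow> (AE x in \<mu>. G x \<le> g x))"

lemma p_weak_gradient_unique:
  assumes "p_weak_gradient p \<mu> f G" and "p_weak_gradient p \<mu> f H"
  shows "AE x in \<mu>. G x = H x"
proof -
  have "AE x in \<mu>. G x \<le> H x" and "AE x in \<mu>. H x \<le> G x"
    using assms by (auto simp: p_weak_gradient_def)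
  then show ?thesis
    by eventually_elim (rule antisym)
qed

definition dual_weight :: "real \<Rightarrow> (real \<Rightarrow> real) \<Rightarrow> real \<Rightarrow> ennreal" where
  "dual_weight p f\<^sub>a x = (if f\<^sub>a x = 0 then \<infinity> else ennreal (f\<^sub>a x powr (1 / (1 - p))))"

definition N_set :: "real \<Rightarrow> (real \<Rightarrow> real) \<Rightarrow> real set" where
  "N_set p f\<^sub>a =
     {x. \<exists>U. open U \<and> x \<in> U \<and> (\<integral>\<^sup>+y\<in>U. dual_weight p f\<^sub>a y \<partial>lborel) < \<infinity>}"

text \<open>A Lipschitz \<open>f\<close> is differentiable at almost every point off the null set \<open>N\<close>, with respect
  to the absolutely continuous part and hence to the whole measure, so the unspecified values of
  \<open>deriv\<close> are harmless.\<close>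

definition df_abs :: "real \<Rightarrow> (real \<Rightarrow> real) \<Rightarrow> real set \<Rightarrow> (real \<Rightarrow> real) \<Rightarrow> real \<Rightarrow> real" where
  "df_abs p f\<^sub>a N f x = (if x \<in> N_set p f\<^sub>a - N then \<bar>deriv f x\<bar> else 0)"

end

theory Submission
  imports Defs
begin

text \<open>On the line a curve can only move along intervals, and this makes the weak gradient computable.
  Write \<open>w\<close> for the density of the absolutely continuous part of \<open>\<mu>\<close>. An absolutely continuous curve
  from \<open>A\<close> to \<open>B\<close> covers the interval between \<open>A\<close> and \<open>B\<close>, so its integral of \<open>g\<close> is at least the
  Lebesgue integral of \<open>g\<close> over that interval (\<open>curve_integral_ge\<close>). Curve integrals therefore see
  only Lebesgue measure, and everything depends on how expensive it is, in terms of
  \<open>\<integral> g powr p \<partial>\<mu>\<close>, to have a large Lebesgue integral over an interval. A Lebesgue null set that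
  carries the singular part costs nothing: densities may vanish there.

  If \<open>w powr (1 / (1 - p))\<close> is integrable on a segment, then Young's inequality
  \<open>h \<le> \<epsilon> * w powr (1 / (1 - p)) + \<epsilon> powr (1 - p) * h powr p * w\<close> bounds the cost from below, so
  the family consisting of this one segment has positive modulus (\<open>Modulus_segment_pos\<close>). An
  inequality that holds for \<open>p\<close>-almost every curve then holds on each such segment:
  \<open>\<bar>f v - f u\<bar>\<close> is at most the integral of \<open>g\<close> over \<open>[u, v]\<close>, and differentiation gives
  \<open>\<bar>f'\<bar> \<le> g\<close> almost everywhere (\<open>derivative_le_of_increment_le_integral\<close>). This is minimality.

  If instead the integral of \<open>w powr (1 / (1 - p))\<close> over an interval is infinite, normalised
  truncations of this very function are densities of integral one and arbitrarily small cost, so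
  the curves whose end points enclose the interval have modulus zero (\<open>Modulus_crossing_null\<close>). Every
  open interval around a point outside \<open>N_set p w\<close> is of this kind. Up to a countable union of null
  families, the open interval between the end points \<open>A\<close> and \<open>B\<close> of a curve is therefore contained
  in \<open>N_set p w\<close>, and there \<open>\<bar>f B - f A\<bar> \<le> \<integral> \<bar>f'\<bar>\<close>. Hence \<open>\<bar>f'\<bar>\<close>, cut off outside \<open>N_set p w\<close>, is an upper gradient.

  The real-variable input is that absolutely continuous functions are differentiable almost
  everywhere and satisfy the area inequality \<open>\<lambda>(\<gamma>(S)) \<le> \<integral>\<^sub>S \<bar>\<gamma>'\<bar>\<close>. Both come from the Vitali
  covering theorem, the former in the form of the comparison principle \<open>Vitali_measure_compare\<close>.\<close>

section \<open>Lebesgue outer measure and Vitali coverings\<close>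

text \<open>Differentiability sets are handled before they are known to be measurable, so sizes of arbitrary sets are
  measured by the outer measure of \<open>lebesgue\<close>; the next lemmas are its basic calculus.\<close>
lemma outer_lebesgue_le:
  fixes E G :: "real set"
  assumes "negligible (E - G)" "G \<in> sets lebesgue"
  shows "outer_measure_of lebesgue E \<le> emeasure lebesgue G"
proof -
  have null: "E - G \<in> null_sets lebesgue" using assms by (simp add: negligible_iff_null_sets)
  have "G \<union> (E - G) \<in> sets lebesgue"
    using null assms by (intro sets.Un) (auto dest: null_setsD2)
  then have "outer_measure_of lebesgue E \<le> emeasure lebesgue (G \<union> (E - G))"
    unfolding outer_measure_of_def by (intro INF_lower) blast
  also have "\<dots> \<le> emeasure lebesgue G + emeasure lebesgue (E - G)"
    using assms null by (intro emeasure_subadditive) (auto dest: null_setsD2)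
  also have "emeasure lebesgue (E - G) = 0"
    using null by (rule null_setsD1)
  finally show ?thesis by simp
qed

lemma outer_lebesgue_open:
  fixes E :: "real set"
  assumes "e > 0"
  obtains U where "open U" "E \<subseteq> U" "emeasure lborel U \<le> outer_measure_of lebesgue E + ennreal e"
proof -
  obtain H where H: "H \<in> sets lebesgue" "E \<subseteq> H" "outer_measure_of lebesgue E = emeasure lebesgue H"
    using outer_measure_of_attain[of E lebesgue] by auto
  obtain U where U: "open U" "H \<subseteq> U" "U - H \<in> lmeasurable" "emeasure lebesgue (U - H) < ennreal e"
    using sets_lebesgue_outer_open[OF H(1) assms] by blast
  have "emeasure lborel U = emeasure lebesgue (H \<union> (U - H))"
    using U by (simp add: Un_absorb1)
  also have "\<dots> \<le> emeasure lebesgue H + emeasure lebesgue (U - H)"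
    using U H by (intro emeasure_subadditive) auto
  also have "\<dots> \<le> outer_measure_of lebesgue E + ennreal e"
    using U H by (intro add_mono) auto
  finally show ?thesis using U H that by blast
qed

lemma outer_lebesgue_zero:
  fixes E :: "real set"
  assumes "outer_measure_of lebesgue E = 0"
  shows "negligible E"
proof -
  obtain H where "H \<in> sets lebesgue" "E \<subseteq> H" "outer_measure_of lebesgue E = emeasure lebesgue H"
    using outer_measure_of_attain[of E lebesgue] by auto
  then show ?thesis
    using assms by (metis negligible_iff_null_sets negligible_subset null_setsI)
qed

text \<open>The comparison principle behind all differentiation arguments below. If every point of \<open>E\<close> lies
  in arbitrarily short intervals on which \<open>M1 \<le> M2\<close>, the Vitali theorem selects disjoint ones among
  them that exhaust \<open>E\<close> up to a null set, and countable additivity transfers the inequality to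
  their union \<open>G\<close>. The intervals may have the point of \<open>E\<close> as an end point, which is what one-sided
  difference quotients require; hence \<open>G\<close> is built from open intervals, which loses only countably
  many points.\<close>
lemma Vitali_measure_compare:
  fixes M1 M2 :: "real measure" and E U :: "real set"
  assumes M: "sets M1 = sets borel" "sets M2 = sets borel"
    and U: "open U" "E \<subseteq> U"
    and E: "\<And>x d. x \<in> E \<Longrightarrow> d > 0 \<Longrightarrow>
        \<exists>u v. u \<le> x \<and> x \<le> v \<and> u < v \<and> v - u < d \<and> emeasure M1 {u<..<v} \<le> emeasure M2 {u<..<v}"
  obtains G where "open G" "G \<subseteq> U" "negligible (E - G)" "emeasure M1 G \<le> emeasure M2 G"
proof -
  define K where "K = {(u, v). u < v \<and> {u..v} \<subseteq> U \<and> emeasure M1 {u<..<v} \<le> emeasure M2 {u<..<v}}"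
  define c where "c = (\<lambda>(u, v). (u + v) / 2 :: real)"
  define r where "r = (\<lambda>(u, v). (v - u) / 2 :: real)"
  have cb: "cball (c i) (r i) = {fst i..snd i}" for i
    by (auto simp: c_def r_def dist_real_def abs_le_iff field_simps split: prod.splits)
  have "\<exists>C. countable C \<and> C \<subseteq> K \<and> pairwise (\<lambda>i j. disjnt (cball (c i) (r i)) (cball (c j) (r j))) C \<and>
     negligible (E - (\<Union>i \<in> C. cball (c i) (r i)))"
  proof (rule Vitali_covering_theorem_cballs[of K r E c])
    show "0 < r i" if "i \<in> K" for i using that by (auto simp: K_def r_def)
    fix x d :: real assume x: "x \<in> E" "0 < d"
    obtain e where e: "e > 0" "cball x e \<subseteq> U"
      using U x(1) open_contains_cball by blast
    obtain u v where uv: "u \<le> x" "x \<le> v" "u < v" "v - u < min d e"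
        "emeasure M1 {u<..<v} \<le> emeasure M2 {u<..<v}"
      using E[OF x(1), of "min d e"] e x by auto
    have "{u..v} \<subseteq> cball x e"
      using uv by (auto simp: dist_real_def)
    with uv e have "(u, v) \<in> K" by (auto simp: K_def)
    moreover have "x \<in> cball (c (u, v)) (r (u, v))" using uv by (simp add: cb)
    moreover have "r (u, v) < d" using uv x by (auto simp: r_def)
    ultimately show "\<exists>i. i \<in> K \<and> x \<in> cball (c i) (r i) \<and> r i < d" by blast
  qed blast
  then obtain C where C: "countable C" "C \<subseteq> K"
    "pairwise (\<lambda>i j. disjnt {fst i..snd i} {fst j..snd j}) C"
    "negligible (E - (\<Union>i \<in> C. {fst i..snd i}))" by (auto simp: cb)
  define G where "G = (\<Union>i\<in>C. {fst i<..<snd i})"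
  have disj: "disjoint_family_on (\<lambda>i. {fst i<..<snd i}) C"
    unfolding disjoint_family_on_def
  proof (intro ballI impI)
    fix i j assume "i \<in> C" "j \<in> C" "i \<noteq> j"
    then have "disjnt {fst i..snd i} {fst j..snd j}" using C(3) by (auto simp: pairwise_def)
    then show "{fst i<..<snd i} \<inter> {fst j<..<snd j} = {}"
      unfolding disjnt_def by (auto simp: disjoint_iff)
  qed
  have "open G" unfolding G_def by auto
  moreover have "G \<subseteq> U"
  proof
    fix x assume "x \<in> G"
    then obtain i where i: "i \<in> C" "x \<in> {fst i..snd i}" by (auto simp: G_def)
    then have "i \<in> K" using C(2) by blast
    then have "{fst i..snd i} \<subseteq> U" by (cases i) (simp add: K_def)
    then show "x \<in> U" using i by blast
  qed
  moreover have "negligible (E - G)"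
  proof (rule negligible_subset)
    show "negligible ((E - (\<Union>i \<in> C. {fst i..snd i})) \<union> (fst ` C \<union> snd ` C))"
      using C(1,4) by (intro negligible_Un)
        (auto simp: negligible_iff_null_sets intro!: null_sets_completionI countable_imp_null_set_lborel)
    have "x \<in> fst ` C \<union> snd ` C" if "x \<in> {fst i..snd i}" "i \<in> C" "x \<notin> G" for x i
      using that by (force simp: G_def)
    then show "E - G \<subseteq> (E - (\<Union>i \<in> C. {fst i..snd i})) \<union> (fst ` C \<union> snd ` C)" by blast
  qed
  moreover have "emeasure M1 G \<le> emeasure M2 G"
  proof -
    have "emeasure M1 G = (\<integral>\<^sup>+i. emeasure M1 {fst i<..<snd i} \<partial>count_space C)"
      unfolding G_def using M C(1) disj by (intro emeasure_UN_countable) auto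
    also have "\<dots> \<le> (\<integral>\<^sup>+i. emeasure M2 {fst i<..<snd i} \<partial>count_space C)"
      using C(2) by (intro nn_integral_mono) (auto simp: K_def)
    also have "\<dots> = emeasure M2 G"
      unfolding G_def using M C(1) disj by (intro emeasure_UN_countable[symmetric]) auto
    finally show ?thesis .
  qed
  ultimately show ?thesis using that by blast
qed

section \<open>Monotone continuous functions are differentiable almost everywhere\<close>

definition slope :: "(real \<Rightarrow> real) \<Rightarrow> real \<Rightarrow> real \<Rightarrow> real" where
  "slope F x y = (F y - F x) / (y - x)"

text \<open>Difference quotients at \<open>x\<close> are turned into increments over short intervals with end point \<open>x\<close>, the
  form required for Vitali coverings.\<close>
lemma slope_interval:
  assumes "frequently (\<lambda>y. P (slope F x y)) (at x)" "d > 0"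
  obtains u v where "u \<le> x" "x \<le> v" "u < v" "v - u < d" "P ((F v - F u) / (v - u))"
proof -
  have "\<exists>y. y \<noteq> x \<and> dist y x < d \<and> P (slope F x y)"
    using assms unfolding frequently_at by blast
  then obtain y where y: "y \<noteq> x" "dist y x < d" "P (slope F x y)" by blast
  show ?thesis
  proof (cases "x < y")
    case True
    then show ?thesis using y that[of x y] by (auto simp: slope_def dist_real_def)
  next
    case False
    have "slope F x y = (F x - F y) / (x - y)"
      using False by (simp add: slope_def minus_divide_divide[of "F y - F x" "y - x", symmetric])
    then show ?thesis using y False that[of y x] by (auto simp: dist_real_def)
  qed
qed

text \<open>The slopes of a monotone function are nonnegative, so their lower and upper limits at \<open>x\<close> lie in
  \<open>[0, \<infinity>]\<close>. If the derivative fails to exist, then either the upper limit is infinite or a pair of rationals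
  separates the two limits. Rationality keeps the number of exceptional sets countable.\<close>
lemma not_differentiable_slope:
  assumes "mono F" "\<not> F differentiable (at x)"
  shows "(\<forall>n::nat. frequently (\<lambda>y. slope F x y \<ge> real n) (at x)) \<or>
    (\<exists>p\<in>\<rat>. \<exists>q\<in>\<rat>. 0 \<le> p \<and> p < q \<and> frequently (\<lambda>y. slope F x y \<le> p) (at x)
        \<and> frequently (\<lambda>y. slope F x y \<ge> q) (at x))"
proof (rule ccontr)
  assume c: "\<not> ?thesis"
  have pos: "slope F x y \<ge> 0" for y
  proof (cases "x \<le> y")
    case True then show ?thesis using assms(1) by (auto simp: slope_def mono_def)
  next
    case False then show ?thesis using assms(1) 
      by (auto simp: slope_def mono_def divide_nonpos_nonpos)
  qed
  define q where "q = (\<lambda>y. ereal (slope F x y))"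
  obtain n :: nat where n: "eventually (\<lambda>y. slope F x y < real n) (at x)"
    using c by (auto simp: not_frequently not_le)
  have "Limsup (at x) q \<le> ereal (real n)"
    by (rule Limsup_bounded) (use n in \<open>auto simp: q_def elim: eventually_mono\<close>)
  moreover have ge: "0 \<le> Liminf (at x) q"
    by (rule Liminf_bounded) (use pos in \<open>auto simp: q_def\<close>)
  moreover have le: "Liminf (at x) q \<le> Limsup (at x) q"
    by (rule Liminf_le_Limsup) simp
  ultimately obtain s where s: "Limsup (at x) q = ereal s"
    by (cases "Limsup (at x) q") auto
  have "Liminf (at x) q = Limsup (at x) q"
  proof (rule ccontr)
    assume "Liminf (at x) q \<noteq> Limsup (at x) q"
    with le have lt: "Liminf (at x) q < Limsup (at x) q" by simp
    obtain l where l: "Liminf (at x) q = ereal l" "0 \<le> l" 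
      using lt ge s by (cases "Liminf (at x) q") auto
    obtain a where a: "a \<in> \<rat>" "l < a" "a < s" using Rats_dense_in_real[of l s] lt l s by auto
    obtain b where b: "b \<in> \<rat>" "a < b" "b < s" using Rats_dense_in_real[of a s] a by auto
    have "frequently (\<lambda>y. slope F x y \<le> a) (at x)"
    proof (rule ccontr)
      assume "\<not> ?thesis"
      then have "eventually (\<lambda>y. slope F x y > a) (at x)" by (simp add: not_frequently not_le)
      then have "ereal a \<le> Liminf (at x) q"
        by (intro Liminf_bounded) (auto simp: q_def elim: eventually_mono)
      then show False using l a by simp
    qed
    moreover have "frequently (\<lambda>y. slope F x y \<ge> b) (at x)"
    proof (rule ccontr)
      assume "\<not> ?thesis"
      then have "eventually (\<lambda>y. slope F x y < b) (at x)" by (simp add: not_frequently not_le)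
      then have "Limsup (at x) q \<le> ereal b"
        by (intro Limsup_bounded) (auto simp: q_def elim: eventually_mono)
      then show False using s b by simp
    qed
    ultimately show False using c a(1,2) b(1,2) l(2) by (meson less_eq_real_def order_le_less_trans)
  qed
  then have "(q \<longlongrightarrow> ereal s) (at x)"
    using s by (intro Liminf_eq_Limsup) auto
  then have "(slope F x \<longlongrightarrow> s) (at x)" unfolding q_def by simp
  then have "(F has_real_derivative s) (at x)"
    unfolding has_field_derivative_iff slope_def[abs_def] .
  then show False using assms(2) real_differentiable_def by blast
qed

context
  fixes F :: "real \<Rightarrow> real"
  assumes mono: "mono F" and cont: "continuous_on UNIV F"
begin

text \<open>The Stieltjes measure of \<open>F\<close> turns increments of \<open>F\<close> into a measure, so that sums of increments over
  disjoint intervals need no combinatorics.\<close>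
lemma interval_measure_Ioo:
  assumes "u < v"
  shows "emeasure (interval_measure F) {u<..<v} = ennreal (F v - F u)"
proof -
  have Icc: "emeasure (interval_measure F) {a..b} = ennreal (F b - F a)" if "a \<le> b" for a b
    using that mono cont
    by (intro emeasure_interval_measure_Icc)
       (auto simp: mono_def continuous_on_subset)
  have "emeasure (interval_measure F) ({u..v} - {u, v}) = emeasure (interval_measure F) {u..v}"
  proof (rule emeasure_Diff_null_set)
    have "{u} \<in> null_sets (interval_measure F)" "{v} \<in> null_sets (interval_measure F)"
      using Icc[of u u] Icc[of v v] by (auto simp: null_sets_def)
    then show "{u, v} \<in> null_sets (interval_measure F)"
      by (metis insert_is_Un null_sets.Un)
  qed auto
  moreover have "{u..v} - {u, v} = {u<..<v}" by auto
  ultimately show ?thesis using Icc[of u v] assms by simp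
qed

text \<open>Cover \<open>E\<close> by intervals of slope at most \<open>p\<close>, with union \<open>G\<close>, then cover \<open>E \<inter> G\<close> inside \<open>G\<close> by
  intervals of slope at least \<open>q\<close>, with union \<open>H\<close>. Comparing the Stieltjes measures of \<open>H \<subseteq> G\<close> gives
  \<open>q * s \<le> p * (s + e)\<close> for the outer measure \<open>s\<close> of \<open>E\<close>, which forces \<open>s = 0\<close>.\<close>
lemma negligible_two_slopes:
  assumes E: "\<And>x. x \<in> E \<Longrightarrow> frequently (\<lambda>y. slope F x y \<le> p) (at x)"
             "\<And>x. x \<in> E \<Longrightarrow> frequently (\<lambda>y. slope F x y \<ge> q) (at x)"
    and pq: "0 \<le> p" "p < q" and bdd: "bounded E"
  shows "negligible E"
proof -
  let ?o = "outer_measure_of lebesgue"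
  have fin: "?o E < \<infinity>"
  proof -
    obtain c where "E \<subseteq> cball 0 c" using bdd using bounded_subset_ballD[of E 0] ball_subset_cball by (metis subset_trans)
    then have "?o E \<le> emeasure lebesgue (cball (0::real) c)"
      by (intro outer_lebesgue_le) auto
    also have "\<dots> < \<infinity>" using lmeasurable_cball[of "0::real" c] by (auto simp: fmeasurable_def)
    finally show ?thesis .
  qed
  define s where "s = enn2real (?o E)"
  have s: "?o E = ennreal s" "0 \<le> s" using fin by (auto simp: s_def less_top)
  have key: "q * s \<le> p * (s + e)" if e: "e > 0" for e
  proof -
    obtain U where U: "open U" "E \<subseteq> U" "emeasure lborel U \<le> ?o E + ennreal e"
      using outer_lebesgue_open[OF e] by blast
    obtain G where G: "open G" "G \<subseteq> U" "negligible (E - G)"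
      "emeasure (interval_measure F) G \<le> emeasure (density lborel (\<lambda>_. ennreal p)) G"
    proof (rule Vitali_measure_compare[of "interval_measure F" "density lborel (\<lambda>_. ennreal p)" U E])
      fix x d :: real assume "x \<in> E" "d > 0"
      from E(1)[OF this(1)] this(2) obtain u v where
        uv: "u \<le> x" "x \<le> v" "u < v" "v - u < d" "(F v - F u) / (v - u) \<le> p"
        by (rule slope_interval)
      have "ennreal (F v - F u) \<le> ennreal p * ennreal (v - u)"
        using uv pq by (subst ennreal_mult[symmetric]) (auto simp: field_simps intro!: ennreal_leI)
      then show "\<exists>u v. u \<le> x \<and> x \<le> v \<and> u < v \<and> v - u < d \<and>
         emeasure (interval_measure F) {u<..<v} \<le> emeasure (density lborel (\<lambda>_. ennreal p)) {u<..<v}"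
        using uv by (intro exI[of _ u] exI[of _ v]) (auto simp: interval_measure_Ioo emeasure_density_const)
    qed (use U in auto)
    obtain H where H: "open H" "H \<subseteq> G" "negligible (E \<inter> G - H)"
      "emeasure (density lborel (\<lambda>_. ennreal q)) H \<le> emeasure (interval_measure F) H"
    proof (rule Vitali_measure_compare[of "density lborel (\<lambda>_. ennreal q)" "interval_measure F" G "E \<inter> G"])
      fix x d :: real assume "x \<in> E \<inter> G" "d > 0"
      then have "x \<in> E" by simp
      from E(2)[OF this] \<open>d > 0\<close> obtain u v where
        uv: "u \<le> x" "x \<le> v" "u < v" "v - u < d" "(F v - F u) / (v - u) \<ge> q"
        by (rule slope_interval)
      have "ennreal (F v - F u) \<ge> ennreal q * ennreal (v - u)"
        using uv pq by (subst ennreal_mult[symmetric]) (auto simp: field_simps intro!: ennreal_leI)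
      then show "\<exists>u v. u \<le> x \<and> x \<le> v \<and> u < v \<and> v - u < d \<and>
         emeasure (density lborel (\<lambda>_. ennreal q)) {u<..<v} \<le> emeasure (interval_measure F) {u<..<v}"
        using uv by (intro exI[of _ u] exI[of _ v]) (auto simp: interval_measure_Ioo emeasure_density_const)
    qed (use G in auto)
    have "negligible (E - H)"
      by (rule negligible_subset[OF negligible_Un[OF G(3) H(3)]]) auto
    then have "?o E \<le> emeasure lborel H"
      using outer_lebesgue_le[of E H] H by simp
    then have "ennreal (q * s) \<le> ennreal q * emeasure lborel H"
      using pq s by (simp add: ennreal_mult mult_left_mono)
    also have "\<dots> = emeasure (density lborel (\<lambda>_. ennreal q)) H"
      using H by (simp add: emeasure_density_const)
    also have "\<dots> \<le> emeasure (interval_measure F) H" by (rule H)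
    also have "\<dots> \<le> emeasure (interval_measure F) G" using G H by (intro emeasure_mono) auto
    also have "\<dots> \<le> emeasure (density lborel (\<lambda>_. ennreal p)) G" by (rule G)
    also have "\<dots> = ennreal p * emeasure lborel G" using G by (simp add: emeasure_density_const)
    also have "\<dots> \<le> ennreal p * emeasure lborel U"
      using G U by (intro mult_left_mono emeasure_mono) auto
    also have "\<dots> \<le> ennreal p * (ennreal s + ennreal e)"
      using U s by (intro mult_left_mono) auto
    also have "\<dots> = ennreal (p * (s + e))"
      using pq s e by (simp add: ennreal_mult ennreal_plus)
    finally show ?thesis using pq s e by (simp add: ennreal_le_iff)
  qed
  have "q * s \<le> p * s"
  proof (rule field_le_epsilon)
    fix e :: real assume "e > 0"
    have "q * s \<le> p * (s + e / (p + 1))" using \<open>e > 0\<close> pq by (intro key) auto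
    also have "\<dots> \<le> p * s + e" using \<open>e > 0\<close> pq by (auto simp: field_simps)
    finally show "q * s \<le> p * s + e" .
  qed
  then have "s = 0" using pq s mult_strict_right_mono[of p q s] by (cases "s = 0") auto
  then show ?thesis using s by (intro outer_lebesgue_zero) simp
qed

text \<open>Slopes of size \<open>n\<close> on a covering of \<open>E\<close> use up \<open>n\<close> times the outer measure of \<open>E\<close> from the finite
  total increment of \<open>F\<close> on \<open>[- c, c]\<close>.\<close>
lemma negligible_infinite_slope:
  assumes E: "\<And>x n::nat. x \<in> E \<Longrightarrow> frequently (\<lambda>y. slope F x y \<ge> real n) (at x)"
    and bdd: "E \<subseteq> {-c<..<c}"
  shows "negligible E"
proof (cases "c > 0")
  case True
  let ?o = "outer_measure_of lebesgue"
  define D where "D = F c - F (- c)"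
  have "?o E \<le> ennreal (D / real n)" if "n > 0" for n :: nat
  proof -
    obtain G where G: "open G" "G \<subseteq> {-c<..<c}" "negligible (E - G)"
      "emeasure (density lborel (\<lambda>_. ennreal n)) G \<le> emeasure (interval_measure F) G"
    proof (rule Vitali_measure_compare[of "density lborel (\<lambda>_. ennreal n)" "interval_measure F" "{-c<..<c}" E])
      fix x d :: real assume "x \<in> E" "d > 0"
      from E[OF this(1)] this(2) obtain u v where
        uv: "u \<le> x" "x \<le> v" "u < v" "v - u < d" "(F v - F u) / (v - u) \<ge> real n"
        by (rule slope_interval)
      have "ennreal (F v - F u) \<ge> ennreal (real n) * ennreal (v - u)"
        using uv by (subst ennreal_mult[symmetric]) (auto simp: field_simps intro!: ennreal_leI)
      then show "\<exists>u v. u \<le> x \<and> x \<le> v \<and> u < v \<and> v - u < d \<and>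
         emeasure (density lborel (\<lambda>_. ennreal n)) {u<..<v} \<le> emeasure (interval_measure F) {u<..<v}"
        using uv by (intro exI[of _ u] exI[of _ v]) (auto simp: interval_measure_Ioo emeasure_density_const)
    qed (use bdd in auto)
    have "ennreal (real n) * ?o E \<le> ennreal (real n) * emeasure lborel G"
      using outer_lebesgue_le[of E G] G by (intro mult_left_mono) auto
    also have "\<dots> = emeasure (density lborel (\<lambda>_. ennreal n)) G"
      using G by (simp add: emeasure_density_const)
    also have "\<dots> \<le> emeasure (interval_measure F) G" by (rule G)
    also have "\<dots> \<le> emeasure (interval_measure F) {-c<..<c}" using G by (intro emeasure_mono) auto
    also have "\<dots> = ennreal D" using True by (simp add: interval_measure_Ioo D_def)
    finally have "ennreal (real n) * ?o E \<le> ennreal D" .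
    then have "ennreal (1 / real n) * (ennreal (real n) * ?o E) \<le> ennreal (1 / real n) * ennreal D"
      by (rule mult_left_mono) simp
    then show ?thesis using that mono True
      by (simp add: mult.assoc[symmetric] ennreal_mult[symmetric] D_def mono_def)
  qed
  then have *: "?o E \<le> ennreal (D / real (Suc n))" for n by blast
  have "(\<lambda>n. ennreal (D / real (Suc n))) \<longlonglongrightarrow> ennreal 0"
    by (intro tendsto_ennrealI) real_asymp
  then have "?o E \<le> ennreal 0"
    using * by (intro LIMSEQ_le_const) auto
  then show ?thesis by (intro outer_lebesgue_zero) simp
qed (use bdd in auto)

theorem monotone_differentiable_negligible:
  "negligible {x. \<not> F differentiable (at x)}"
proof -
  define I where "I = (\<lambda>k::nat. {x \<in> {-real k<..<real k}. \<forall>n::nat. frequently (\<lambda>y. slope F x y \<ge> real n) (at x)})"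
  define T where "T = (\<lambda>(p, q, k::nat). {x \<in> {-real k<..<real k}. 
      frequently (\<lambda>y. slope F x y \<le> p) (at x) \<and> frequently (\<lambda>y. slope F x y \<ge> q) (at x)})"
  define J where "J = {(p, q, k::nat). p \<in> \<rat> \<and> q \<in> \<rat> \<and> 0 \<le> p \<and> p < (q::real)}"
  have "J \<subseteq> \<rat> \<times> \<rat> \<times> UNIV" by (auto simp: J_def)
  then have cJ: "countable J" 
    by (rule countable_subset) (intro countable_SIGMA countable_rat countableI_type)
  have "negligible (\<Union>k. I k)"
    by (intro negligible_countable_Union[of "range I", simplified])
      (auto simp: I_def intro!: negligible_infinite_slope)
  moreover have "negligible (\<Union>i\<in>J. T i)"
  proof (rule negligible_countable_Union)
    have "negligible (T i)" if "i \<in> J" for i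
    proof (cases i)
      case (fields p q k)
      then show ?thesis
        using that unfolding fields T_def prod.case
        by (intro negligible_two_slopes[of _ p q])
           (auto simp: J_def intro: bounded_subset[of "{-real k<..<real k}"])
    qed
    then show "negligible S" if "S \<in> T ` J" for S using that by blast
  qed (use cJ in auto)
  moreover have "{x. \<not> F differentiable (at x)} \<subseteq> (\<Union>k. I k) \<union> (\<Union>i\<in>J. T i)"
  proof
    fix x assume "x \<in> {x. \<not> F differentiable (at x)}"
    then have nd: "\<not> F differentiable (at x)" by simp
    obtain k :: nat where "\<bar>x\<bar> < real k" using reals_Archimedean2 by blast
    then have k: "x \<in> {-real k<..<real k}" by auto
    from not_differentiable_slope[OF mono nd] show "x \<in> (\<Union>k. I k) \<union> (\<Union>i\<in>J. T i)"
    proof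
      assume "\<forall>n::nat. frequently (\<lambda>y. slope F x y \<ge> real n) (at x)"
      then have "x \<in> I k" using k by (auto simp: I_def)
      then show ?thesis by blast
    next
      assume "\<exists>p\<in>\<rat>. \<exists>q\<in>\<rat>. 0 \<le> p \<and> p < q \<and> frequently (\<lambda>y. slope F x y \<le> p) (at x)
        \<and> frequently (\<lambda>y. slope F x y \<ge> q) (at x)"
      then obtain p q where "(p, q, k) \<in> J" "x \<in> T (p, q, k)"
        using k by (auto simp: J_def T_def)
      then show ?thesis by blast
    qed
  qed
  ultimately show ?thesis using negligible_Un negligible_subset by blast
qed

end

section \<open>Absolutely continuous functions are differentiable almost everywhere\<close>

lemma continuous_on_real_uniformI:
  assumes "\<And>e. e > 0 \<Longrightarrow> \<exists>d>0. \<forall>x y. x \<le> y \<and> y - x < d \<longrightarrow> \<bar>f y - f x\<bar> \<le> e"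
  shows "continuous_on UNIV (f :: real \<Rightarrow> real)"
proof (rule uniformly_continuous_imp_continuous)
  show "uniformly_continuous_on UNIV f"
    unfolding uniformly_continuous_on_def
  proof (intro allI impI)
    fix e :: real assume "e > 0"
    then obtain d where d: "d > 0" "\<And>x y. x \<le> y \<Longrightarrow> y - x < d \<Longrightarrow> \<bar>f y - f x\<bar> \<le> e / 2"
      using assms[of "e / 2"] by auto
    have "\<bar>f y - f x\<bar> \<le> e / 2" if "\<bar>y - x\<bar> < d" for x y
      using d(2)[of x y] d(2)[of y x] that by (cases "x \<le> y") (auto simp: abs_minus_commute)
    then show "\<exists>d>0. \<forall>x\<in>UNIV. \<forall>x'\<in>UNIV. dist x' x < d \<longrightarrow> dist (f x') (f x) < e"
      using d(1) \<open>e > 0\<close> by (intro exI[of _ d]) (force simp: dist_real_def)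
  qed
qed

text \<open>Total lengths of disjoint intervals are bounded through Lebesgue measure; this verifies the
  smallness condition in the definition of absolute continuity.\<close>
lemma sum_length_le_measure:
  fixes u v :: "'i \<Rightarrow> real"
  assumes "finite I" "\<And>i. i \<in> I \<Longrightarrow> u i \<le> v i" "disjoint_family_on (\<lambda>i. {u i<..<v i}) I"
    and "\<And>i. i \<in> I \<Longrightarrow> {u i<..<v i} \<subseteq> A" "A \<in> sets borel"
  shows "ennreal (\<Sum>i\<in>I. v i - u i) \<le> emeasure lborel A"
proof -
  have "ennreal (\<Sum>i\<in>I. v i - u i) = (\<Sum>i\<in>I. emeasure lborel {u i<..<v i})"
    using assms(2) by (subst sum_ennreal[symmetric]) auto
  also have "\<dots> = emeasure lborel (\<Union>i\<in>I. {u i<..<v i})"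
    using assms by (intro sum_emeasure) auto
  also have "\<dots> \<le> emeasure lborel A"
    using assms by (intro emeasure_mono) auto
  finally show ?thesis .
qed

text \<open>The definition numbers the intervals by an initial segment of \<open>nat\<close>; coverings produce finite families
  with other index types.\<close>
lemma absolutely_continuous_family:
  assumes "absolutely_continuous_curve_on a b \<gamma>" "e > 0"
  obtains \<delta> where "\<delta> > 0" "\<And>(I :: 'i set) u v. \<lbrakk>finite I; \<And>i. i \<in> I \<Longrightarrow> a \<le> u i \<and> u i \<le> v i \<and> v i \<le> b;
      disjoint_family_on (\<lambda>i. {u i<..<v i}) I; (\<Sum>i\<in>I. v i - u i) < \<delta>\<rbrakk>
      \<Longrightarrow> (\<Sum>i\<in>I. \<bar>\<gamma> (v i) - \<gamma> (u i)\<bar>) < e"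
proof -
  obtain \<delta> where \<delta>: "\<delta> > 0" "\<And>(n::nat) u v.
        (\<forall>i<n. a \<le> u i \<and> u i \<le> v i \<and> v i \<le> b) \<and>
        disjoint_family_on (\<lambda>i. {u i<..<v i}) {..<n} \<and>
        (\<Sum>i<n. v i - u i) < \<delta> \<Longrightarrow> (\<Sum>i<n. \<bar>\<gamma> (v i) - \<gamma> (u i)\<bar>) < e"
    using assms unfolding absolutely_continuous_curve_on_def by blast
  show ?thesis
  proof (rule that[OF \<delta>(1)])
    fix I :: "'i set" and u v
    assume I: "finite I" "\<And>i. i \<in> I \<Longrightarrow> a \<le> u i \<and> u i \<le> v i \<and> v i \<le> b"
      "disjoint_family_on (\<lambda>i. {u i<..<v i}) I" "(\<Sum>i\<in>I. v i - u i) < \<delta>"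
    obtain h where h: "bij_betw h {..<card I} I"
      using ex_bij_betw_nat_finite[OF I(1)] by (auto simp: atLeast0LessThan)
    have "(\<Sum>i<card I. \<bar>\<gamma> ((v \<circ> h) i) - \<gamma> ((u \<circ> h) i)\<bar>) < e"
    proof (rule \<delta>(2)[of _ "u \<circ> h" "v \<circ> h"], intro conjI allI impI)
      show "disjoint_family_on (\<lambda>i. {(u \<circ> h) i<..<(v \<circ> h) i}) {..<card I}"
        using I(3) h unfolding disjoint_family_on_def bij_betw_def inj_on_def by (auto 0 4)
      show "(\<Sum>i<card I. (v \<circ> h) i - (u \<circ> h) i) < \<delta>"
        using I(4) sum.reindex_bij_betw[OF h, of "\<lambda>i. v i - u i"] by simp
    qed (use I(2) bij_betwE[OF h] in auto)
    then show "(\<Sum>i\<in>I. \<bar>\<gamma> (v i) - \<gamma> (u i)\<bar>) < e"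
      using sum.reindex_bij_betw[OF h, of "\<lambda>i. \<bar>\<gamma> (v i) - \<gamma> (u i)\<bar>"] by simp
  qed
qed

text \<open>Families of disjoint intervals with gaps, as in the definition of absolute continuity, take the place of
  partitions in the definition of the variation.\<close>
definition interval_family :: "real \<Rightarrow> real \<Rightarrow> nat \<Rightarrow> (nat \<Rightarrow> real) \<Rightarrow> (nat \<Rightarrow> real) \<Rightarrow> bool" where
  "interval_family a b n u v \<longleftrightarrow> (\<forall>i<n. a \<le> u i \<and> u i \<le> v i \<and> v i \<le> b) \<and>
     disjoint_family_on (\<lambda>i. {u i<..<v i}) {..<n}"

definition variation_sum :: "(real \<Rightarrow> real) \<Rightarrow> nat \<Rightarrow> (nat \<Rightarrow> real) \<Rightarrow> (nat \<Rightarrow> real) \<Rightarrow> real" where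
  "variation_sum \<gamma> n u v = (\<Sum>i<n. \<bar>\<gamma> (v i) - \<gamma> (u i)\<bar>)"

definition variation :: "(real \<Rightarrow> real) \<Rightarrow> real \<Rightarrow> real \<Rightarrow> real" where
  "variation \<gamma> a b = Sup {variation_sum \<gamma> n u v |n u v. interval_family a b n u v}"

text \<open>Disjointness of open intervals as an inequality between end points is stable under cutting the
  intervals at a point \<open>x\<close>, as in \<open>clamp_disjoint\<close>; degenerate intervals are allowed. Thus a
  family of intervals splits at \<open>x\<close> into two families.\<close>
lemma Ioo_disjoint_iff:
  "{a<..<b} \<inter> {c<..<d} = {} \<longleftrightarrow> min b d \<le> max a (c::real)"
  by (simp add: Int_greaterThanLessThan)

lemma interval_familyD:
  assumes "interval_family a b n u v" "i < n"
  shows "a \<le> u i" "u i \<le> v i" "v i \<le> b"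
  using assms by (auto simp: interval_family_def)

lemma interval_family_iff:
  "interval_family a b n u v \<longleftrightarrow> (\<forall>i<n. a \<le> u i \<and> u i \<le> v i \<and> v i \<le> b) \<and>
     (\<forall>i<n. \<forall>j<n. i \<noteq> j \<longrightarrow> min (v i) (v j) \<le> max (u i) (u j))"
  unfolding interval_family_def disjoint_family_on_def Ioo_disjoint_iff by auto

lemma clamp_disjoint:
  fixes p q r s x :: real
  assumes "min p q \<le> max r s"
  shows "min (min p x) (min q x) \<le> max (min r x) (min s x)"
    and "min (max p x) (max q x) \<le> max (max r x) (max s x)"
  using assms by (auto simp: min_def max_def split: if_splits)

lemma interval_family_length:
  assumes "interval_family a b n u v" "a \<le> b"
  shows "(\<Sum>i<n. v i - u i) \<le> b - a"
proof -
  have "ennreal (\<Sum>i<n. v i - u i) \<le> emeasure lborel {a..b}"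
  proof (rule sum_length_le_measure)
    show "{u i<..<v i} \<subseteq> {a..b}" if "i \<in> {..<n}" for i
      using interval_familyD[OF assms(1), of i] that by auto
  qed (use assms in \<open>auto simp: interval_family_def\<close>)
  then show ?thesis using assms(2) by (simp add: ennreal_le_iff)
qed

lemma absolutely_continuous_small_variation:
  assumes "absolutely_continuous_curve_on a b \<gamma>" "e > 0"
  obtains \<delta> where "\<delta> > 0" "\<And>x y n u v. \<lbrakk>a \<le> x; x \<le> y; y \<le> b; y - x < \<delta>; interval_family x y n u v\<rbrakk>
      \<Longrightarrow> variation_sum \<gamma> n u v < e"
proof -
  obtain \<delta> where \<delta>: "\<delta> > 0" "\<And>(n::nat) u v.
        (\<forall>i<n. a \<le> u i \<and> u i \<le> v i \<and> v i \<le> b) \<and>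
        disjoint_family_on (\<lambda>i. {u i<..<v i}) {..<n} \<and>
        (\<Sum>i<n. v i - u i) < \<delta> \<Longrightarrow> (\<Sum>i<n. \<bar>\<gamma> (v i) - \<gamma> (u i)\<bar>) < e"
    using assms unfolding absolutely_continuous_curve_on_def by blast
  show ?thesis
  proof (rule that[OF \<delta>(1)])
    fix x y n u v assume *: "a \<le> x" "x \<le> y" "y \<le> b" "y - x < \<delta>" "interval_family x y n u v"
    show "variation_sum \<gamma> n u v < e"
      unfolding variation_sum_def
    proof (rule \<delta>(2), intro conjI allI impI)
      show "disjoint_family_on (\<lambda>i. {u i<..<v i}) {..<n}" using * by (simp add: interval_family_def)
      show "(\<Sum>i<n. v i - u i) < \<delta>" using interval_family_length[OF *(5)] * by simp
      show "a \<le> u i" "u i \<le> v i" "v i \<le> b" if "i < n" for i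
        using interval_familyD[OF *(5) that] * by auto
    qed
  qed
qed

lemma absolutely_continuous_modulus:
  assumes "absolutely_continuous_curve_on a b \<gamma>" "e > 0"
  obtains d where "d > 0" "\<And>x y. a \<le> x \<Longrightarrow> x \<le> y \<Longrightarrow> y \<le> b \<Longrightarrow> y - x < d \<Longrightarrow> \<bar>\<gamma> y - \<gamma> x\<bar> < e"
proof -
  from assms obtain \<delta> where \<delta>: "\<delta> > 0" "\<And>x y n u v. \<lbrakk>a \<le> x; x \<le> y; y \<le> b; y - x < \<delta>; interval_family x y n u v\<rbrakk>
      \<Longrightarrow> variation_sum \<gamma> n u v < e"
    by (rule absolutely_continuous_small_variation) blast
  show ?thesis
  proof (rule that[OF \<delta>(1)])
    fix x y assume "a \<le> x" "x \<le> y" "y \<le> b" "y - x < \<delta>"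
    moreover from this have "interval_family x y 1 (\<lambda>_. x) (\<lambda>_. y)" by (simp add: interval_family_iff)
    ultimately have "variation_sum \<gamma> 1 (\<lambda>_. x) (\<lambda>_. y) < e" by (rule \<delta>(2))
    then show "\<bar>\<gamma> y - \<gamma> x\<bar> < e" by (simp add: variation_sum_def)
  qed
qed

lemma variation_least:
  assumes "\<And>n u v. interval_family a b n u v \<Longrightarrow> variation_sum \<gamma> n u v \<le> B"
  shows "variation \<gamma> a b \<le> B"
  unfolding variation_def
proof (rule cSup_least)
  have "interval_family a b 0 u v" for u v by (auto simp: interval_family_def disjoint_family_on_def)
  then show "{variation_sum \<gamma> n u v |n u v. interval_family a b n u v} \<noteq> {}" by blast
qed (use assms in auto)

context
  fixes \<gamma> :: "real \<Rightarrow> real" and c d :: real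
  assumes bounded_sums: "\<And>n u v. interval_family c d n u v \<Longrightarrow> variation_sum \<gamma> n u v \<le> 1"
begin

lemma variation_upper:
  assumes "interval_family c x n u v" "x \<le> d"
  shows "variation_sum \<gamma> n u v \<le> variation \<gamma> c x"
  unfolding variation_def
proof (rule cSup_upper)
  have "interval_family c d n u v" if "interval_family c x n u v" for n u v
    using that assms(2) by (auto simp: interval_family_def intro: order_trans)
  then show "bdd_above {variation_sum \<gamma> n u v |n u v. interval_family c x n u v}"
    using bounded_sums by (intro bdd_aboveI[of _ 1]) blast
qed (use assms in auto)

text \<open>Appending the interval \<open>[x, y]\<close> to a family in \<open>[c, x]\<close> gives a family in \<open>[c, y]\<close>. In consequence both
  \<open>variation\<close> and its difference with \<open>\<gamma>\<close> are nondecreasing.\<close>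
lemma variation_superadditive:
  assumes "c \<le> x" "x \<le> y" "y \<le> d"
  shows "variation \<gamma> c x + \<bar>\<gamma> y - \<gamma> x\<bar> \<le> variation \<gamma> c y"
proof -
  have "variation \<gamma> c x \<le> variation \<gamma> c y - \<bar>\<gamma> y - \<gamma> x\<bar>"
  proof (rule variation_least)
    fix n u v assume f: "interval_family c x n u v"
    have "interval_family c y (Suc n) (u(n := x)) (v(n := y))"
      unfolding interval_family_iff
    proof (intro conjI allI impI)
      fix i assume "i < Suc n"
      then show "c \<le> (u(n := x)) i" "(u(n := x)) i \<le> (v(n := y)) i" "(v(n := y)) i \<le> y"
        using interval_familyD[OF f, of i] assms by (auto simp: less_Suc_eq)
    next
      fix i j assume ij: "i < Suc n" "j < Suc n" "i \<noteq> j"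
      have "min (v i) (v j) \<le> max (u i) (u j)" if "i < n" "j < n"
        using f that ij unfolding interval_family_iff by blast
      then show "min ((v(n := y)) i) ((v(n := y)) j) \<le> max ((u(n := x)) i) ((u(n := x)) j)"
        using ij interval_familyD(3)[OF f, of i] interval_familyD(3)[OF f, of j]
        by (cases "i = n"; cases "j = n") (auto simp: min_le_iff_disj le_max_iff_disj)
    qed
    from variation_upper[OF this] assms
    have "variation_sum \<gamma> (Suc n) (u(n := x)) (v(n := y)) \<le> variation \<gamma> c y" by simp
    then show "variation_sum \<gamma> n u v \<le> variation \<gamma> c y - \<bar>\<gamma> y - \<gamma> x\<bar>"
      by (simp add: variation_sum_def)
  qed
  then show ?thesis by simp
qed

text \<open>Each interval of a family in \<open>[c, y]\<close> is cut at \<open>x\<close>. Combined with absolute continuity, which makes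
  the variation over short intervals small, this yields continuity of \<open>variation\<close>.\<close>
lemma variation_subadditive:
  assumes "c \<le> x" "x \<le> y" "y \<le> d"
    and e: "\<And>n u v. interval_family x y n u v \<Longrightarrow> variation_sum \<gamma> n u v \<le> e"
  shows "variation \<gamma> c y \<le> variation \<gamma> c x + e"
proof (rule variation_least)
  fix n u v assume f: "interval_family c y n u v"
  have "interval_family c x n (\<lambda>i. min (u i) x) (\<lambda>i. min (v i) x)"
    using f assms(1-3) unfolding interval_family_iff
    by (intro conjI allI impI clamp_disjoint) (auto simp: min_le_iff_disj le_max_iff_disj)
  then have 1: "variation_sum \<gamma> n (\<lambda>i. min (u i) x) (\<lambda>i. min (v i) x) \<le> variation \<gamma> c x"
    using assms by (intro variation_upper) auto
  have "interval_family x y n (\<lambda>i. max (u i) x) (\<lambda>i. max (v i) x)"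
    using f assms(1-3) unfolding interval_family_iff
    by (intro conjI allI impI clamp_disjoint) (auto simp: min_le_iff_disj le_max_iff_disj)
  then have 2: "variation_sum \<gamma> n (\<lambda>i. max (u i) x) (\<lambda>i. max (v i) x) \<le> e" by (rule e)
  have "variation_sum \<gamma> n u v \<le> variation_sum \<gamma> n (\<lambda>i. min (u i) x) (\<lambda>i. min (v i) x)
      + variation_sum \<gamma> n (\<lambda>i. max (u i) x) (\<lambda>i. max (v i) x)"
    unfolding variation_sum_def sum.distrib[symmetric]
    by (rule sum_mono) (auto simp: min_def max_def)
  then show "variation_sum \<gamma> n u v \<le> variation \<gamma> c x + e" using 1 2 by simp
qed

end

text \<open>The Jordan decomposition: on an interval of finite variation \<open>\<gamma>\<close> is the difference of the monotone
  continuous functions \<open>V\<close> and \<open>W\<close>. Clamping the argument to \<open>[c, d]\<close> extends both to the whole line.\<close>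
lemma absolutely_continuous_differentiable_local:
  assumes ac: "absolutely_continuous_curve_on a b \<gamma>" and cd: "a \<le> c" "c < d" "d \<le> b"
    and bounded_sums: "\<And>n u v. interval_family c d n u v \<Longrightarrow> variation_sum \<gamma> n u v \<le> 1"
  shows "negligible {x \<in> {c<..<d}. \<not> \<gamma> differentiable (at x)}"
proof -
  \<comment> \<open>Outside \<open>[c, d]\<close> nothing is known about \<open>\<gamma>\<close>, and Stieltjes measures need functions on the whole line.\<close>
  define cl where "cl = (\<lambda>t. max c (min d t))"
  define V where "V = (\<lambda>t. variation \<gamma> c (cl t))"
  define W where "W = (\<lambda>t. V t - \<gamma> (cl t))"
  have cl: "c \<le> cl t" "cl t \<le> d" "mono cl" for t using cd by (auto simp: cl_def mono_def)
  have cl_diff: "cl y - cl x \<le> y - x" if "x \<le> y" for x y using that cd by (auto simp: cl_def)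
  have incr: "V x + \<bar>\<gamma> (cl y) - \<gamma> (cl x)\<bar> \<le> V y" if "x \<le> y" for x y
    unfolding V_def using variation_superadditive[of c d \<gamma> "cl x" "cl y", OF bounded_sums] cl that
    by (auto simp: mono_def)
  have mono_V: "mono V" and mono_W: "mono W"
    using incr unfolding mono_def W_def by (force simp: abs_le_iff)+
  have cont_V: "continuous_on UNIV V"
  proof (rule continuous_on_real_uniformI)
    fix e :: real assume "e > 0"
    with ac obtain \<delta> where \<delta>: "\<delta> > 0" "\<And>x y n u v. \<lbrakk>a \<le> x; x \<le> y; y \<le> b; y - x < \<delta>; interval_family x y n u v\<rbrakk>
      \<Longrightarrow> variation_sum \<gamma> n u v < e"
      by (rule absolutely_continuous_small_variation) blast
    have "\<bar>V y - V x\<bar> \<le> e" if xy: "x \<le> y" "y - x < \<delta>" for x y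
    proof -
      have "V y \<le> V x + e"
        unfolding V_def
      proof (rule variation_subadditive[of c d \<gamma> "cl x" "cl y" e, OF bounded_sums])
        fix n u v assume f: "interval_family (cl x) (cl y) n u v"
        have "a \<le> cl x" "cl x \<le> cl y" "cl y \<le> b" "cl y - cl x < \<delta>"
          using cl(1)[of x] cl(2)[of y] cl(3) cd xy cl_diff[of x y] by (auto simp: mono_def)
        from \<delta>(2)[OF this f] show "variation_sum \<gamma> n u v \<le> e" by simp
      qed (use cl xy in \<open>auto simp: mono_def\<close>)
      then show ?thesis using mono_V xy by (auto simp: mono_def)
    qed
    then show "\<exists>d>0. \<forall>x y. x \<le> y \<and> y - x < d \<longrightarrow> \<bar>V y - V x\<bar> \<le> e" using \<delta>(1) by blast
  qed
  have cont_\<gamma>: "continuous_on UNIV (\<lambda>t. \<gamma> (cl t))"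
  proof (rule continuous_on_real_uniformI)
    fix e :: real assume "e > 0"
    with ac obtain \<delta> where \<delta>: "\<delta> > 0"
      "\<And>x y. a \<le> x \<Longrightarrow> x \<le> y \<Longrightarrow> y \<le> b \<Longrightarrow> y - x < \<delta> \<Longrightarrow> \<bar>\<gamma> y - \<gamma> x\<bar> < e"
      by (rule absolutely_continuous_modulus) blast
    show "\<exists>d>0. \<forall>x y. x \<le> y \<and> y - x < d \<longrightarrow> \<bar>\<gamma> (cl y) - \<gamma> (cl x)\<bar> \<le> e"
      using \<delta>(1) 
    proof (intro exI[of _ \<delta>] conjI allI impI, goal_cases)
      case (2 x y)
      then show ?case
        using \<delta>(2)[of "cl x" "cl y"] cl(1,2)[of x] cl(1,2)[of y] cl(3) cd cl_diff[of x y]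
        by (auto simp: mono_def)
    qed
  qed
  have cont_W: "continuous_on UNIV W"
    unfolding W_def by (intro continuous_intros cont_V cont_\<gamma>)
  have sub: "\<gamma> differentiable (at x)" if x: "x \<in> {c<..<d}" and "V differentiable (at x)" "W differentiable (at x)" for x
  proof -
    have "(\<lambda>t. V t - W t) differentiable (at x)" using that by (intro differentiable_diff)
    then obtain D where D: "((\<lambda>t. V t - W t) has_derivative D) (at x)" by (auto simp: differentiable_def)
    have "(\<gamma> has_derivative D) (at x)"
      by (rule has_derivative_transform_within_open[OF D, of "{c<..<d}"])
         (use x in \<open>auto simp: W_def cl_def\<close>)
    then show ?thesis by (auto simp: differentiable_def)
  qed
  show ?thesis
    by (rule negligible_subset[OF negligible_Un[OF monotone_differentiable_negligible[OF mono_V cont_V]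
         monotone_differentiable_negligible[OF mono_W cont_W]]]) (use sub in auto)
qed

text \<open>Differentiability is local, so finiteness of the variation is only needed on intervals so short that
  absolute continuity bounds the variation by one; countably many rational intervals suffice.\<close>
theorem absolutely_continuous_differentiable:
  assumes ac: "absolutely_continuous_curve_on a b \<gamma>"
  shows "negligible {x \<in> {a<..<b}. \<not> \<gamma> differentiable (at x)}"
proof -
  from ac zero_less_one obtain \<delta> where \<delta>: "\<delta> > 0" "\<And>x y n u v. \<lbrakk>a \<le> x; x \<le> y; y \<le> b; y - x < \<delta>; interval_family x y n u v\<rbrakk>
      \<Longrightarrow> variation_sum \<gamma> n u v < 1"
    by (rule absolutely_continuous_small_variation) blast
  define J where "J = {(c, d). c \<in> \<rat> \<and> d \<in> \<rat> \<and> a \<le> c \<and> c < d \<and> d \<le> b \<and> d - c < \<delta>}"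
  define T where "T = (\<lambda>(c, d). {x \<in> {c<..<d}. \<not> \<gamma> differentiable (at x)})"
  have "J \<subseteq> \<rat> \<times> \<rat>" by (auto simp: J_def)
  then have cJ: "countable J"
    by (rule countable_subset) (intro countable_SIGMA countable_rat)
  have "negligible (T i)" if "i \<in> J" for i
  proof (cases i)
    case (Pair c d)
    then have cd: "a \<le> c" "c < d" "d \<le> b" "d - c < \<delta>" using that by (auto simp: J_def)
    have "variation_sum \<gamma> n u v \<le> 1" if f: "interval_family c d n u v" for n u v
      using \<delta>(2)[OF _ _ _ _ f] cd by (auto intro: less_imp_le)
    then show ?thesis
      unfolding Pair T_def prod.case
      using absolutely_continuous_differentiable_local[OF ac cd(1-3)] by blast
  qed
  then have "negligible (\<Union>i\<in>J. T i)"
    using cJ by (intro negligible_countable_Union) auto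
  moreover have "{x \<in> {a<..<b}. \<not> \<gamma> differentiable (at x)} \<subseteq> (\<Union>i\<in>J. T i)"
  proof
    fix x assume x: "x \<in> {x \<in> {a<..<b}. \<not> \<gamma> differentiable (at x)}"
    obtain c where c: "c \<in> \<rat>" "max a (x - \<delta>/2) < c" "c < x"
      using Rats_dense_in_real[of "max a (x - \<delta>/2)" x] x \<delta>(1) by auto
    obtain d where d: "d \<in> \<rat>" "x < d" "d < min b (x + \<delta>/2)"
      using Rats_dense_in_real[of x "min b (x + \<delta>/2)"] x \<delta>(1) by auto
    have "(c, d) \<in> J" "x \<in> T (c, d)" using c d x by (auto simp: J_def T_def)
    then show "x \<in> (\<Union>i\<in>J. T i)" by blast
  qed
  ultimately show ?thesis using negligible_subset by blast
qed

section \<open>The area inequality for absolutely continuous functions\<close>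

lemma absolutely_continuous_imp_continuous_on:
  assumes ac: "absolutely_continuous_curve_on a b \<gamma>"
  shows "continuous_on {a..b} \<gamma>"
  unfolding continuous_on_iff
proof (intro ballI allI impI)
  fix x e :: real assume x: "x \<in> {a..b}" and e: "e > 0"
  from ac e obtain \<delta> where \<delta>: "\<delta> > 0"
      "\<And>x y. a \<le> x \<Longrightarrow> x \<le> y \<Longrightarrow> y \<le> b \<Longrightarrow> y - x < \<delta> \<Longrightarrow> \<bar>\<gamma> y - \<gamma> x\<bar> < e"
    by (rule absolutely_continuous_modulus) blast
  have "dist (\<gamma> y) (\<gamma> x) < e" if "y \<in> {a..b}" "dist y x < \<delta>" for y
    using \<delta>(2)[of x y] \<delta>(2)[of y x] that x by (cases "x \<le> y") (auto simp: dist_real_def)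
  then show "\<exists>d>0. \<forall>x'\<in>{a..b}. dist x' x < d \<longrightarrow> dist (\<gamma> x') (\<gamma> x) < e" using \<delta>(1) by blast
qed

text \<open>The Lusin property. A null set lies in an open set of measure less than \<open>\<delta>\<close>, and is covered by nonoverlapping compact
  intervals inside that set. The image of each of them is the interval between two values
  \<open>\<gamma> (s K)\<close> and \<open>\<gamma> (t K)\<close>, and absolute continuity bounds the sum of these differences.\<close>
theorem absolutely_continuous_image_negligible:
  assumes ac: "absolutely_continuous_curve_on a b \<gamma>" and Z: "Z \<subseteq> {a<..<b}" "negligible Z"
  shows "negligible (\<gamma> ` Z)"
proof (cases "a < b")
  case ab: True
  show ?thesis
    unfolding negligible_outer_le
  proof (intro allI impI)
    fix e :: real assume "e > 0"
    with ac obtain \<delta> where \<delta>: "\<delta> > 0" "\<And>(I :: real set set) u v. \<lbrakk>finite I; \<And>i. i \<in> I \<Longrightarrow> a \<le> u i \<and> u i \<le> v i \<and> v i \<le> b;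
        disjoint_family_on (\<lambda>i. {u i<..<v i}) I; (\<Sum>i\<in>I. v i - u i) < \<delta>\<rbrakk>
        \<Longrightarrow> (\<Sum>i\<in>I. \<bar>\<gamma> (v i) - \<gamma> (u i)\<bar>) < e"
      by (rule absolutely_continuous_family) blast
    obtain U0 where U0: "open U0" "Z \<subseteq> U0" "emeasure lborel U0 \<le> outer_measure_of lebesgue Z + ennreal (\<delta>/2)"
      using outer_lebesgue_open[of "\<delta>/2" Z] \<delta>(1) by auto
    define U where "U = U0 \<inter> {a<..<b}"
    have Z0: "outer_measure_of lebesgue Z = 0"
      using Z(2) by (simp add: negligible_iff_null_sets null_sets_def)
    have "emeasure lborel U \<le> emeasure lborel U0"
      using U0(1) by (intro emeasure_mono) (auto simp: U_def)
    also have "\<dots> \<le> ennreal (\<delta>/2)" using U0(3) unfolding Z0 by simp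
    finally have U3: "emeasure lborel U \<le> ennreal (\<delta>/2)" .
    have U: "open U" "Z \<subseteq> U" "U \<subseteq> {a<..<b}"
      unfolding U_def using U0(1,2) Z(1) open_Int[OF U0(1) open_greaterThanLessThan[of a b]] by blast+
    \<comment> \<open>The gauge forces every interval tagged by a point of \<open>Z\<close> into \<open>U\<close>.\<close>
    define g where "g = (\<lambda>x. if x \<in> U then U else UNIV)"
    have gauge: "gauge g" using U(1) by (simp add: gauge_def g_def)
    have sub: "Z \<subseteq> cbox a b" using Z(1) by (auto simp: cbox_interval)
    have ne: "box a b \<noteq> {}" using ab by simp
    obtain \<D> where \<D>: "countable \<D>" "\<Union>\<D> \<subseteq> cbox a b"
      "\<And>K. K \<in> \<D> \<Longrightarrow> interior K \<noteq> {} \<and> (\<exists>c d. K = cbox c d)"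
      "pairwise (\<lambda>A B. interior A \<inter> interior B = {}) \<D>"
      "\<And>K. K \<in> \<D> \<Longrightarrow> \<exists>x \<in> Z \<inter> K. K \<subseteq> g x"
      "\<And>u v. cbox u v \<in> \<D> \<Longrightarrow> \<exists>n. \<forall>i \<in> Basis. v \<bullet> i - u \<bullet> i = (b \<bullet> i - a \<bullet> i) / 2^n"
      "Z \<subseteq> \<Union>\<D>"
      by (rule covering_lemma[OF sub ne gauge]) (rule that)
    have KU: "K \<subseteq> U" if "K \<in> \<D>" for K using \<D>(5)[OF that] U(2) by (auto simp: g_def split: if_splits)
    have "\<exists>s t. s \<in> K \<and> t \<in> K \<and> (\<forall>y\<in>K. \<gamma> s \<le> \<gamma> y \<and> \<gamma> y \<le> \<gamma> t)" if K: "K \<in> \<D>" for K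
    proof -
      have ne: "K \<noteq> {}" "compact K" using \<D>(3)[OF K] by auto
      have "continuous_on K \<gamma>"
        by (rule continuous_on_subset[OF absolutely_continuous_imp_continuous_on[OF ac]])
           (use KU[OF K] U(3) in fastforce)
      from continuous_attains_inf[OF ne(2,1) this] continuous_attains_sup[OF ne(2,1) this]
      show ?thesis by blast
    qed
    then obtain s t where st: "\<And>K. K \<in> \<D> \<Longrightarrow> s K \<in> K \<and> t K \<in> K \<and> (\<forall>y\<in>K. \<gamma> (s K) \<le> \<gamma> y \<and> \<gamma> y \<le> \<gamma> (t K))"
      by metis
    define T where "T = (\<Union>K\<in>\<D>. {\<gamma> (s K)..\<gamma> (t K)})"
    define u where "u = (\<lambda>K. min (s K) (t K))"
    define v where "v = (\<lambda>K. max (s K) (t K))"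
    have uvK: "{u K<..<v K} \<subseteq> interior K" if K: "K \<in> \<D>" for K
    proof -
      obtain c d where "K = {c..d}" using \<D>(3)[OF K] by (auto simp: cbox_interval)
      then show ?thesis using st[OF K] by (auto simp: u_def v_def)
    qed
    have bnd: "measure lebesgue (\<Union>K\<in>I. {\<gamma> (s K)..\<gamma> (t K)}) \<le> e" if I: "I \<subseteq> \<D>" "finite I" for I
    proof -
      have disj: "disjoint_family_on (\<lambda>K. {u K<..<v K}) I"
        unfolding disjoint_family_on_def
      proof (intro ballI impI)
        fix A B assume AB: "A \<in> I" "B \<in> I" "A \<noteq> B"
        then have "interior A \<inter> interior B = {}" using \<D>(4) I by (auto simp: pairwise_def)
        then show "{u A<..<v A} \<inter> {u B<..<v B} = {}" using uvK AB I by blast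
      qed
      have "ennreal (\<Sum>K\<in>I. v K - u K) \<le> emeasure lborel U"
      proof (rule sum_length_le_measure[OF I(2) _ disj])
        show "{u K<..<v K} \<subseteq> U" if "K \<in> I" for K
          using uvK[of K] KU[of K] interior_subset[of K] that I by blast
      qed (use U in \<open>auto simp: u_def v_def\<close>)
      also note U3
      finally have len: "(\<Sum>K\<in>I. v K - u K) < \<delta>" using \<delta>(1) by (simp add: ennreal_le_iff)
      have "(\<Sum>K\<in>I. \<bar>\<gamma> (v K) - \<gamma> (u K)\<bar>) < e"
      proof (rule \<delta>(2)[OF I(2) _ disj len])
        fix K assume "K \<in> I"
        then have "s K \<in> U" "t K \<in> U" using st KU I by auto
        then show "a \<le> u K \<and> u K \<le> v K \<and> v K \<le> b"
          using U(3) by (auto simp: u_def v_def min_def max_def)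
      qed
      moreover have "measure lebesgue (\<Union>K\<in>I. {\<gamma> (s K)..\<gamma> (t K)}) \<le> (\<Sum>K\<in>I. measure lebesgue {\<gamma> (s K)..\<gamma> (t K)})"
        using I by (intro measure_UNION_le) auto
      moreover have "(\<Sum>K\<in>I. measure lebesgue {\<gamma> (s K)..\<gamma> (t K)}) = (\<Sum>K\<in>I. \<bar>\<gamma> (v K) - \<gamma> (u K)\<bar>)"
      proof (rule sum.cong[OF refl])
        fix K assume "K \<in> I"
        then have "\<gamma> (s K) \<le> \<gamma> (t K)" using st I by blast
        then show "measure lebesgue {\<gamma> (s K)..\<gamma> (t K)} = \<bar>\<gamma> (v K) - \<gamma> (u K)\<bar>"
          by (auto simp: u_def v_def min_def max_def)
      qed
      ultimately show ?thesis by simp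
    qed
    have "T \<in> lmeasurable" "measure lebesgue T \<le> e"
      unfolding T_def
      by (auto intro!: fmeasurable_UN_bound[OF \<D>(1) _ bnd] measure_UN_bound[OF \<D>(1) _ bnd])
    moreover have "\<gamma> ` Z \<subseteq> T"
    proof
      fix z assume "z \<in> \<gamma> ` Z"
      then obtain x where "x \<in> Z" "z = \<gamma> x" by blast
      then obtain K where "K \<in> \<D>" "x \<in> K" using \<D>(7) by blast
      then show "z \<in> T" using st[of K] \<open>z = \<gamma> x\<close> by (auto simp: T_def)
    qed
    ultimately show "\<exists>T. \<gamma> ` Z \<subseteq> T \<and> T \<in> lmeasurable \<and> measure lebesgue T \<le> e" by blast
  qed
qed (use Z in auto)

text \<open>Balls centred at \<open>x\<close> are essential: \<open>\<bar>\<gamma> y - \<gamma> x\<bar> \<le> c * \<bar>y - x\<bar>\<close> maps \<open>cball x r\<close> into a ball of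
  radius \<open>c * r\<close>, without the factor two that uncentred intervals would cost. The null set left over by
  the Vitali covering has a null image.\<close>
lemma outer_image_le_open:
  assumes ac: "absolutely_continuous_curve_on a b \<gamma>" and S: "S \<subseteq> {a<..<b}" and c: "c > 0"
    and D: "\<And>x. x \<in> S \<Longrightarrow> (\<gamma> has_real_derivative D x) (at x)" "\<And>x. x \<in> S \<Longrightarrow> \<bar>D x\<bar> < c"
    and U: "open U" "S \<subseteq> U"
  shows "outer_measure_of lebesgue (\<gamma> ` S) \<le> ennreal c * emeasure lborel U"
proof (cases "emeasure lborel U = \<infinity>")
  case False
  define K where "K = {(x, r). r > 0 \<and> cball x r \<subseteq> U \<and> (\<forall>y\<in>cball x r. \<bar>\<gamma> y - \<gamma> x\<bar> \<le> c * \<bar>y - x\<bar>)}"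
  have "\<exists>C. countable C \<and> C \<subseteq> K \<and> pairwise (\<lambda>i j. disjnt (cball (fst i) (snd i)) (cball (fst j) (snd j))) C \<and>
     negligible (S - (\<Union>i \<in> C. cball (fst i) (snd i)))"
  proof (rule Vitali_covering_theorem_cballs[of K snd S fst])
    show "0 < snd i" if "i \<in> K" for i using that by (auto simp: K_def)
    fix x d :: real assume x: "x \<in> S" "0 < d"
    have "((\<lambda>y. \<bar>(\<gamma> y - \<gamma> x) / (y - x)\<bar>) \<longlongrightarrow> \<bar>D x\<bar>) (at x)"
      using D(1)[OF x(1)] unfolding has_field_derivative_iff by (rule tendsto_rabs)
    then have "eventually (\<lambda>y. \<bar>(\<gamma> y - \<gamma> x) / (y - x)\<bar> < c) (at x)"
      using D(2)[OF x(1)] by (rule order_tendstoD)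
    then obtain e where e: "e > 0" "\<And>y. y \<noteq> x \<Longrightarrow> dist y x < e \<Longrightarrow> \<bar>(\<gamma> y - \<gamma> x) / (y - x)\<bar> < c"
      by (auto simp: eventually_at)
    obtain e' where e': "e' > 0" "cball x e' \<subseteq> U" using U x(1) open_contains_cball by blast
    define r where "r = min (min (e / 2) e') (d / 2)"
    have r: "r > 0" "r < e" "r \<le> e'" "r < d" using e e' x by (auto simp: r_def)
    have "\<bar>\<gamma> y - \<gamma> x\<bar> \<le> c * \<bar>y - x\<bar>" if "y \<in> cball x r" for y
      using e(2)[of y] that r by (cases "y = x") (auto simp: dist_commute abs_divide field_simps)
    moreover have "cball x r \<subseteq> U" using r e' by auto
    ultimately have "(x, r) \<in> K" using r by (auto simp: K_def)
    then show "\<exists>i. i \<in> K \<and> x \<in> cball (fst i) (snd i) \<and> snd i < d"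
      using r by (intro exI[of _ "(x, r)"]) auto
  qed blast
  then obtain C where C: "countable C" "C \<subseteq> K"
     "pairwise (\<lambda>i j. disjnt (cball (fst i) (snd i)) (cball (fst j) (snd j))) C"
     "negligible (S - (\<Union>i \<in> C. cball (fst i) (snd i)))" by blast
  define G where "G = (\<Union>i\<in>C. cball (\<gamma> (fst i)) (c * snd i))"
  have KD: "snd i > 0" "cball (fst i) (snd i) \<subseteq> U" "\<And>y. y \<in> cball (fst i) (snd i) \<Longrightarrow> \<bar>\<gamma> y - \<gamma> (fst i)\<bar> \<le> c * \<bar>y - fst i\<bar>"
    if "i \<in> C" for i using subsetD[OF C(2) that] by (auto simp: K_def split_beta)
  have bnd: "measure lebesgue (\<Union>i\<in>I. cball (\<gamma> (fst i)) (c * snd i)) \<le> c * measure lborel U" if I: "I \<subseteq> C" "finite I" for I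
  proof -
    have "ennreal (\<Sum>i\<in>I. (fst i + snd i) - (fst i - snd i)) \<le> emeasure lborel U"
    proof (rule sum_length_le_measure[OF I(2)])
      have Ioo: "{fst i - snd i<..<fst i + snd i} \<subseteq> cball (fst i) (snd i)" for i :: "real \<times> real"
        by (auto simp: dist_real_def)
      show "disjoint_family_on (\<lambda>i. {fst i - snd i<..<fst i + snd i}) I"
        unfolding disjoint_family_on_def
      proof (intro ballI impI)
        fix i j assume "i \<in> I" "j \<in> I" "i \<noteq> j"
        then have "disjnt (cball (fst i) (snd i)) (cball (fst j) (snd j))"
          using C(3) I by (auto simp: pairwise_def)
        then show "{fst i - snd i<..<fst i + snd i} \<inter> {fst j - snd j<..<fst j + snd j} = {}"
          using Ioo[of i] Ioo[of j] unfolding disjnt_def by blast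
      qed
      show "{fst i - snd i<..<fst i + snd i} \<subseteq> U" if "i \<in> I" for i
        using KD(2)[of i] Ioo[of i] that I by blast
      show "fst i - snd i \<le> fst i + snd i" if "i \<in> I" for i using KD(1)[of i] that I by auto
    qed (use U in auto)
    also have "emeasure lborel U = ennreal (measure lborel U)"
      using False by (intro emeasure_eq_ennreal_measure) auto
    finally have "(\<Sum>i\<in>I. 2 * snd i) \<le> measure lborel U"
      by (simp add: ennreal_le_iff)
    then have "c * (\<Sum>i\<in>I. 2 * snd i) \<le> c * measure lborel U" using c by simp
    moreover have "measure lebesgue (\<Union>i\<in>I. cball (\<gamma> (fst i)) (c * snd i)) \<le> (\<Sum>i\<in>I. measure lebesgue (cball (\<gamma> (fst i)) (c * snd i)))"
      using I by (intro measure_UNION_le) auto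
    moreover have "(\<Sum>i\<in>I. measure lebesgue (cball (\<gamma> (fst i)) (c * snd i))) = c * (\<Sum>i\<in>I. 2 * snd i)"
      unfolding sum_distrib_left
    proof (rule sum.cong[OF refl])
      fix i assume "i \<in> I"
      then have "0 < c * snd i" using KD(1)[of i] I c by auto
      then show "measure lebesgue (cball (\<gamma> (fst i)) (c * snd i)) = c * (2 * snd i)"
        by (simp add: cball_eq_atLeastAtMost)
    qed
    ultimately show ?thesis by simp
  qed
  have G: "G \<in> lmeasurable" "measure lebesgue G \<le> c * measure lborel U"
    unfolding G_def
    by (auto intro!: fmeasurable_UN_bound[OF C(1) _ bnd] measure_UN_bound[OF C(1) _ bnd])
  have "negligible (\<gamma> ` (S - (\<Union>i \<in> C. cball (fst i) (snd i))))"
    by (rule absolutely_continuous_image_negligible[OF ac _ C(4)]) (use S in auto)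
  moreover have "\<gamma> ` S - G \<subseteq> \<gamma> ` (S - (\<Union>i \<in> C. cball (fst i) (snd i)))"
  proof
    fix z assume z: "z \<in> \<gamma> ` S - G"
    then obtain x where x: "x \<in> S" "z = \<gamma> x" by auto
    have "x \<notin> cball (fst i) (snd i)" if i: "i \<in> C" for i
    proof
      assume xi: "x \<in> cball (fst i) (snd i)"
      have "\<bar>\<gamma> x - \<gamma> (fst i)\<bar> \<le> c * \<bar>x - fst i\<bar>" by (rule KD(3)[OF i xi])
      also have "\<dots> \<le> c * snd i" using xi c by (intro mult_left_mono) (auto simp: dist_real_def)
      finally have "\<gamma> x \<in> G" using i by (auto simp: G_def dist_real_def abs_minus_commute)
      then show False using z x by auto
    qed
    then show "z \<in> \<gamma> ` (S - (\<Union>i \<in> C. cball (fst i) (snd i)))" using x by auto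
  qed
  ultimately have "negligible (\<gamma> ` S - G)" by (rule negligible_subset)
  then have "outer_measure_of lebesgue (\<gamma> ` S) \<le> emeasure lebesgue G"
    using G by (intro outer_lebesgue_le) auto
  also have "\<dots> = ennreal (measure lebesgue G)"
    using G(1) by (simp add: emeasure_eq_measure2)
  also have "\<dots> \<le> ennreal (c * measure lborel U)" using G(2) by (rule ennreal_leI)
  also have "\<dots> = ennreal c * emeasure lborel U"
    using False c by (simp add: ennreal_mult emeasure_eq_ennreal_measure)
  finally show ?thesis .
qed (use c in \<open>simp add: ennreal_mult_top\<close>)

lemma outer_lebesgue_countable_subadditive:
  fixes A :: "nat \<Rightarrow> real set"
  shows "outer_measure_of lebesgue (\<Union>n. A n) \<le> (\<Sum>n. outer_measure_of lebesgue (A n))"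
proof -
  have "\<exists>H\<in>sets lebesgue. A n \<subseteq> H \<and> outer_measure_of lebesgue (A n) = emeasure lebesgue H" for n
    by (rule outer_measure_of_attain) simp
  then obtain H where H: "\<And>n. H n \<in> sets lebesgue" "\<And>n. A n \<subseteq> H n"
     "\<And>n. outer_measure_of lebesgue (A n) = emeasure lebesgue (H n)" by metis
  have "outer_measure_of lebesgue (\<Union>n. A n) \<le> outer_measure_of lebesgue (\<Union>n. H n)"
    using H(2) by (intro outer_measure_of_mono) blast
  also have "\<dots> = emeasure lebesgue (\<Union>n. H n)" using H(1) by simp
  also have "\<dots> \<le> (\<Sum>n. emeasure lebesgue (H n))"
    using H(1) by (intro emeasure_subadditive_countably) auto
  finally show ?thesis by (simp add: H(3))
qed

lemma outer_image_le:
  assumes ac: "absolutely_continuous_curve_on a b \<gamma>" and S: "S \<subseteq> {a<..<b}" "S \<in> sets borel" and c: "c > 0"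
    and D: "\<And>x. x \<in> S \<Longrightarrow> (\<gamma> has_real_derivative D x) (at x)" "\<And>x. x \<in> S \<Longrightarrow> \<bar>D x\<bar> < c"
  shows "outer_measure_of lebesgue (\<gamma> ` S) \<le> ennreal c * emeasure lborel S"
proof (rule ennreal_le_epsilon)
  fix e :: real assume e: "e > 0"
  obtain U where U: "open U" "S \<subseteq> U" "emeasure lborel U \<le> outer_measure_of lebesgue S + ennreal (e / c)"
    using outer_lebesgue_open[of "e/c" S] e c by auto
  have "outer_measure_of lebesgue (\<gamma> ` S) \<le> ennreal c * emeasure lborel U"
    by (rule outer_image_le_open[OF ac S(1) c D U(1,2)])
  also have "\<dots> \<le> ennreal c * (emeasure lborel S + ennreal (e / c))"
    using U(3) S by (intro mult_left_mono) auto
  also have "\<dots> = ennreal c * emeasure lborel S + ennreal e"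
    using e c by (simp add: distrib_left ennreal_mult[symmetric])
  finally show "outer_measure_of lebesgue (\<gamma> ` S) \<le> ennreal c * emeasure lborel S + ennreal e" .
qed

text \<open>The area inequality. On the set where \<open>\<bar>D\<bar>\<close> lies between \<open>k * \<eta>\<close> and \<open>(k + 1) * \<eta>\<close> the
  previous estimate exceeds the integral of \<open>\<bar>D\<bar>\<close> by at most \<open>\<eta>\<close> times the measure of the set.\<close>
lemma outer_image_le_integral:
  assumes ac: "absolutely_continuous_curve_on a b \<gamma>" and S: "S \<subseteq> {a<..<b}" "S \<in> sets borel"
    and D: "\<And>x. x \<in> S \<Longrightarrow> (\<gamma> has_real_derivative D x) (at x)" and [measurable]: "D \<in> borel_measurable borel"
  shows "outer_measure_of lebesgue (\<gamma> ` S) \<le> (\<integral>\<^sup>+x\<in>S. ennreal \<bar>D x\<bar> \<partial>lborel)"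
proof (rule ennreal_le_epsilon)
  note [measurable] = S(2)
  fix e :: real assume e: "e > 0"
  define \<eta> where "\<eta> = e / (\<bar>b - a\<bar> + 1)"
  have \<eta>: "\<eta> > 0" "\<eta> * \<bar>b - a\<bar> \<le> e" using e by (auto simp: \<eta>_def field_simps)
  define P where "P = (\<lambda>k::nat. {x \<in> S. real k * \<eta> \<le> \<bar>D x\<bar> \<and> \<bar>D x\<bar> < (real k + 1) * \<eta>})"
  have [measurable]: "P k \<in> sets borel" for k unfolding P_def by measurable
  define h where "h = (\<lambda>x. ennreal (\<bar>D x\<bar> + \<eta>))"
  have [measurable]: "h \<in> borel_measurable borel" unfolding h_def by measurable
  have SP: "S = (\<Union>k. P k)"
  proof -
    have "x \<in> P (nat \<lfloor>\<bar>D x\<bar> / \<eta>\<rfloor>)" if "x \<in> S" for x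
    proof -
      have "real (nat \<lfloor>\<bar>D x\<bar> / \<eta>\<rfloor>) = of_int \<lfloor>\<bar>D x\<bar> / \<eta>\<rfloor>" using \<eta> by simp
      moreover have "of_int \<lfloor>\<bar>D x\<bar> / \<eta>\<rfloor> * \<eta> \<le> \<bar>D x\<bar>"
        by (rule pos_le_divide_eq[THEN iffD1, OF \<eta>(1) of_int_floor_le])
      moreover have "\<bar>D x\<bar> < (of_int \<lfloor>\<bar>D x\<bar> / \<eta>\<rfloor> + 1) * \<eta>"
        by (rule pos_divide_less_eq[THEN iffD1, OF \<eta>(1) real_of_int_floor_add_one_gt])
      ultimately show ?thesis using that by (simp add: P_def)
    qed
    then show ?thesis by (auto simp: P_def)
  qed
  have disj: "disjoint_family P"
    unfolding disjoint_family_on_def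
  proof (intro ballI impI)
    fix m n :: nat assume "m \<noteq> n"
    have *: "P m \<inter> P n = {}" if "m < n" for m n
    proof -
      have "real m + 1 \<le> real n" using that by simp
      then have "(real m + 1) * \<eta> \<le> real n * \<eta>" using \<eta> by (intro mult_right_mono) auto
      then show ?thesis by (auto simp: P_def)
    qed
    show "P m \<inter> P n = {}" using *[of m n] *[of n m] \<open>m \<noteq> n\<close> by (cases "m < n") auto
  qed
  have "outer_measure_of lebesgue (\<gamma> ` S) = outer_measure_of lebesgue (\<Union>k. \<gamma> ` P k)"
    by (subst SP) (simp only: image_UN)
  also have "\<dots> \<le> (\<Sum>k. outer_measure_of lebesgue (\<gamma> ` P k))"
    by (rule outer_lebesgue_countable_subadditive)
  also have "\<dots> \<le> (\<Sum>k. emeasure (density lborel h) (P k))"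
  proof (rule suminf_le)
    fix k
    have "outer_measure_of lebesgue (\<gamma> ` P k) \<le> ennreal ((real k + 1) * \<eta>) * emeasure lborel (P k)"
      by (rule outer_image_le[OF ac, of _ _ D]) (use S(1) \<eta> D in \<open>simp_all add: P_def subset_iff\<close>)
    also have "\<dots> = (\<integral>\<^sup>+x. ennreal ((real k + 1) * \<eta>) * indicator (P k) x \<partial>lborel)"
      by (simp add: nn_integral_cmult_indicator)
    also have "\<dots> \<le> (\<integral>\<^sup>+x. h x * indicator (P k) x \<partial>lborel)"
      by (intro nn_integral_mono) (auto simp: indicator_def P_def h_def algebra_simps intro!: ennreal_leI)
    also have "\<dots> = emeasure (density lborel h) (P k)" by (simp add: emeasure_density)
    finally show "outer_measure_of lebesgue (\<gamma> ` P k) \<le> emeasure (density lborel h) (P k)" .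
  qed auto
  also have "\<dots> = emeasure (density lborel h) (\<Union>k. P k)"
    using disj by (intro suminf_emeasure) auto
  also have "\<dots> = (\<integral>\<^sup>+x. (ennreal \<bar>D x\<bar> * indicator S x + ennreal \<eta> * indicator S x) \<partial>lborel)"
    using \<eta> by (subst SP[symmetric]) (auto simp: emeasure_density h_def distrib_right ennreal_plus intro!: nn_integral_cong)
  also have "\<dots> = (\<integral>\<^sup>+x\<in>S. ennreal \<bar>D x\<bar> \<partial>lborel) + ennreal \<eta> * emeasure lborel S"
    by (subst nn_integral_add) (auto simp: nn_integral_cmult_indicator)
  also have "ennreal \<eta> * emeasure lborel S \<le> ennreal e"
  proof -
    have "emeasure lborel S \<le> emeasure lborel {a<..<b}" using S by (intro emeasure_mono) auto
    also have "\<dots> \<le> ennreal \<bar>b - a\<bar>" by (cases "a \<le> b") auto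
    finally have "ennreal \<eta> * emeasure lborel S \<le> ennreal \<eta> * ennreal \<bar>b - a\<bar>" by (rule mult_left_mono) simp
    also have "\<dots> \<le> ennreal e" using \<eta> by (simp add: ennreal_mult[symmetric] ennreal_leI)
    finally show ?thesis .
  qed
  finally show "outer_measure_of lebesgue (\<gamma> ` S) \<le> (\<integral>\<^sup>+x\<in>S. ennreal \<bar>D x\<bar> \<partial>lborel) + ennreal e"
    by (simp add: add_left_mono)
qed


text \<open>For Borel \<open>h\<close> this is a Borel function on the whole line, because \<open>lim\<close> of a sequence of Borel functions is
  Borel even where the sequence diverges; it represents the derivative of \<open>h\<close> wherever that exists.\<close>
definition right_quotient_lim :: "(real \<Rightarrow> real) \<Rightarrow> real \<Rightarrow> real" where
  "right_quotient_lim h x = lim (\<lambda>n. (h (x + 1 / real (Suc n)) - h x) * real (Suc n))"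

lemma right_quotient_lim_borel [measurable]:
  assumes [measurable]: "h \<in> borel_measurable borel"
  shows "right_quotient_lim h \<in> borel_measurable borel"
  unfolding right_quotient_lim_def[abs_def] by measurable

lemma right_quotient_lim_eq:
  assumes "(h has_real_derivative d) (at x)"
  shows "right_quotient_lim h x = d"
proof -
  have "((\<lambda>y. (h y - h x) / (y - x)) \<longlongrightarrow> d) (at x)"
    using assms by (simp add: has_field_derivative_iff)
  moreover have "filterlim (\<lambda>n. x + 1 / real (Suc n)) (at x) sequentially"
    unfolding filterlim_at
  proof (intro conjI)
    have "(\<lambda>n. x + 1 / real (Suc n)) \<longlonglongrightarrow> x + 0"
      by (intro tendsto_intros LIMSEQ_Suc lim_1_over_n)
    then show "(\<lambda>n. x + 1 / real (Suc n)) \<longlonglongrightarrow> x" by simp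
  qed auto
  ultimately have "(\<lambda>n. (h (x + 1 / real (Suc n)) - h x) / (x + 1 / real (Suc n) - x)) \<longlonglongrightarrow> d"
    by (rule filterlim_compose)
  then have "(\<lambda>n. (h (x + 1 / real (Suc n)) - h x) * real (Suc n)) \<longlonglongrightarrow> d"
    by (simp add: divide_inverse)
  then show ?thesis unfolding right_quotient_lim_def by (rule limI)
qed

lemma negligible_borel_hull:
  fixes A :: "real set"
  assumes "negligible A"
  obtains B where "B \<in> null_sets lborel" "A \<subseteq> B"
  using assms by (auto simp: negligible_iff_null_sets null_sets_completion_iff2)

text \<open>By the intermediate value theorem the curve covers the interval between its end points, and the
  area inequality says that \<open>\<nu>\<close>, the image under the curve of \<open>\<bar>\<gamma>'\<bar>\<close> times Lebesgue measure,
  dominates Lebesgue measure \<open>\<rho>\<close> on that interval. The parameters where \<open>\<gamma>\<close> is not differentiable form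
  a null set and, by the Lusin property, have a null image.\<close>
theorem curve_integral_ge:
  assumes ac: "absolutely_continuous_curve_on a b \<gamma>" and ab: "a \<le> b"
    and g[measurable]: "g \<in> borel_measurable borel"
  shows "(\<integral>\<^sup>+y\<in>{min (\<gamma> a) (\<gamma> b)..max (\<gamma> a) (\<gamma> b)}. g y \<partial>lborel) \<le> curve_integral g (a, b, \<gamma>)"
proof -
  define A where "A = min (\<gamma> a) (\<gamma> b)"
  define B where "B = max (\<gamma> a) (\<gamma> b)"
  \<comment> \<open>The values of \<open>\<gamma>\<close> outside \<open>[a, b]\<close> are arbitrary; clamping the parameter makes the curve Borel.\<close>
  define \<phi> where "\<phi> = (\<lambda>s. \<gamma> (max a (min b s)))"
  have \<phi>_eq: "\<phi> s = \<gamma> s" if "s \<in> {a..b}" for s using that by (auto simp: \<phi>_def)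
  have "continuous_on UNIV \<phi>"
    unfolding \<phi>_def
    by (rule continuous_on_compose2[OF absolutely_continuous_imp_continuous_on[OF ac]])
       (use ab in \<open>auto intro!: continuous_intros\<close>)
  then have \<phi>[measurable]: "\<phi> \<in> borel_measurable borel" by (rule borel_measurable_continuous_onI)
  obtain Z where Z: "Z \<in> null_sets lborel" "{x \<in> {a<..<b}. \<not> \<gamma> differentiable (at x)} \<subseteq> Z"
    using negligible_borel_hull[OF absolutely_continuous_differentiable[OF ac]] .
  then have [measurable]: "Z \<in> sets borel" by auto
  define S where "S = {a<..<b} - Z"
  have [measurable]: "S \<in> sets borel" by (simp add: S_def)
  define D where "D = right_quotient_lim \<phi>"
  have [measurable]: "D \<in> borel_measurable borel" by (simp add: D_def)
  have deriv: "(\<gamma> has_real_derivative D x) (at x)" if x: "x \<in> S" for x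
  proof -
    have "\<gamma> differentiable (at x)" using x Z by (auto simp: S_def)
    then obtain d where d: "(\<gamma> has_real_derivative d) (at x)" by (auto simp: real_differentiable_def)
    have "(\<phi> has_real_derivative d) (at x)"
      by (rule has_field_derivative_transform_within_open[OF d, of "{a<..<b}"])
         (use x \<phi>_eq in \<open>auto simp: S_def\<close>)
    then show ?thesis using d right_quotient_lim_eq by (simp add: D_def)
  qed
  define w where "w = (\<lambda>s. ennreal \<bar>D s\<bar> * indicator S s)"
  have [measurable]: "w \<in> borel_measurable borel" by (simp add: w_def)
  define \<nu> where "\<nu> = distr (density lborel w) borel \<phi>"
  define \<rho> where "\<rho> = density lborel (indicator {A..B})"
  have "emeasure \<rho> E \<le> emeasure \<nu> E" if E[measurable]: "E \<in> sets borel" for E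
  proof -
    define T where "T = S \<inter> \<phi> -` E"
    have T[measurable]: "T \<in> sets borel"
      unfolding T_def using measurable_sets[OF \<phi> E] by auto
    have "emeasure \<rho> E = (\<integral>\<^sup>+x. indicator (E \<inter> {A..B}) x \<partial>lborel)"
      by (simp add: \<rho>_def emeasure_density indicator_inter_arith mult.commute)
    also have "\<dots> = emeasure lebesgue (E \<inter> {A..B})" by simp
    also have "\<dots> = outer_measure_of lebesgue (E \<inter> {A..B})" by (intro outer_measure_of_eq[symmetric]) simp
    also have "\<dots> \<le> outer_measure_of lebesgue (\<gamma> ` T)"
    proof -
      obtain H where H: "H \<in> sets lebesgue" "\<gamma> ` T \<subseteq> H"
          "outer_measure_of lebesgue (\<gamma> ` T) = emeasure lebesgue H"
        using outer_measure_of_attain[of "\<gamma> ` T" lebesgue] by auto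
      have "negligible (\<gamma> ` (Z \<inter> {a<..<b}))"
        by (rule absolutely_continuous_image_negligible[OF ac])
           (use Z(1) in \<open>auto simp: negligible_iff_null_sets null_sets_completion_iff2\<close>)
      then have neg: "negligible (\<gamma> ` (Z \<inter> {a<..<b}) \<union> {A, B})"
        by (intro negligible_Un) auto
      have "E \<inter> {A..B} - H \<subseteq> \<gamma> ` (Z \<inter> {a<..<b}) \<union> {A, B}"
      proof
        fix y assume y: "y \<in> E \<inter> {A..B} - H"
        show "y \<in> \<gamma> ` (Z \<inter> {a<..<b}) \<union> {A, B}"
        proof (cases "y = A \<or> y = B")
          case False
          have "\<exists>s. a \<le> s \<and> s \<le> b \<and> \<gamma> s = y"
          proof (cases "\<gamma> a \<le> \<gamma> b")
            case True
            then show ?thesis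
              using IVT'[of \<gamma> a y b] y ab absolutely_continuous_imp_continuous_on[OF ac] by (auto simp: A_def B_def)
          next
            case False
            then show ?thesis
              using IVT2'[of \<gamma> b y a] y ab absolutely_continuous_imp_continuous_on[OF ac] by (auto simp: A_def B_def)
          qed
          then obtain s where s: "a \<le> s" "s \<le> b" "\<gamma> s = y" by blast
          moreover have "s \<noteq> a" "s \<noteq> b" using s False by (auto simp: A_def B_def min_def max_def split: if_splits)
          ultimately have s': "s \<in> {a<..<b}" by auto
          have "s \<in> Z"
          proof (rule ccontr)
            assume "s \<notin> Z"
            then have "s \<in> T" using s s' y \<phi>_eq[of s] by (auto simp: T_def S_def)
            then show False using H(2) s y by blast
          qed
          then show ?thesis using s s' by blast
        qed auto
      qed
      then have "negligible (E \<inter> {A..B} - H)" using neg negligible_subset by blast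
      then show ?thesis using outer_lebesgue_le[OF _ H(1)] H(3) by metis
    qed
    also have "\<dots> \<le> (\<integral>\<^sup>+x\<in>T. ennreal \<bar>D x\<bar> \<partial>lborel)"
      by (rule outer_image_le_integral[OF ac]) (use deriv in \<open>auto simp: T_def S_def\<close>)
    also have "\<dots> = emeasure \<nu> E"
      unfolding \<nu>_def using measurable_sets[OF \<phi> E]
      by (subst emeasure_distr) (auto simp: emeasure_density w_def T_def indicator_def intro!: nn_integral_cong)
    finally show ?thesis .
  qed
  then have "\<rho> \<le> \<nu>" by (subst le_measure) (auto simp: \<rho>_def \<nu>_def)
  have "(\<integral>\<^sup>+y\<in>{A..B}. g y \<partial>lborel) = (\<integral>\<^sup>+y. g y \<partial>\<rho>)"
    by (simp add: \<rho>_def nn_integral_density mult.commute)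
  also have "\<dots> \<le> (\<integral>\<^sup>+y. g y \<partial>\<nu>)"
    using \<open>\<rho> \<le> \<nu>\<close> by (intro nn_integral_mono_measure) (auto simp: \<rho>_def \<nu>_def)
  also have "\<dots> = (\<integral>\<^sup>+s. w s * g (\<phi> s) \<partial>lborel)"
    by (simp add: \<nu>_def nn_integral_distr nn_integral_density)
  also have "\<dots> \<le> curve_integral g (a, b, \<gamma>)"
    unfolding curve_integral.simps
  proof (rule nn_integral_mono)
    fix s
    show "w s * g (\<phi> s) \<le> g (\<gamma> s) * ennreal \<bar>deriv \<gamma> s\<bar> * indicator {a..b} s"
    proof (cases "s \<in> S")
      case True
      then have "deriv \<gamma> s = D s" using deriv by (intro DERIV_imp_deriv)
      moreover have "s \<in> {a..b}" using True by (auto simp: S_def)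
      ultimately show ?thesis using True \<phi>_eq[of s] by (simp add: w_def mult.commute)
    qed (simp add: w_def)
  qed
  finally show ?thesis by (simp add: A_def B_def)
qed

section \<open>Lipschitz functions\<close>

lemma lipschitz_absolutely_continuous:
  fixes f :: "real \<Rightarrow> real"
  assumes "L-lipschitz_on UNIV f"
  shows "absolutely_continuous_curve_on a b f"
  unfolding absolutely_continuous_curve_on_def
proof (intro allI impI)
  fix e :: real assume e: "e > 0"
  have L: "L \<ge> 0" using assms by (rule lipschitz_on_nonneg)
  show "\<exists>\<delta>>0. \<forall>(n::nat) u v. (\<forall>i<n. a \<le> u i \<and> u i \<le> v i \<and> v i \<le> b) \<and>
      disjoint_family_on (\<lambda>i. {u i<..<v i}) {..<n} \<and> (\<Sum>i<n. v i - u i) < \<delta> \<longrightarrow>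
      (\<Sum>i<n. \<bar>f (v i) - f (u i)\<bar>) < e"
  proof (intro exI[of _ "e / (L + 1)"] conjI allI impI)
    show "e / (L + 1) > 0" using e L by simp
    fix n :: nat and u v :: "nat \<Rightarrow> real"
    assume *: "(\<forall>i<n. a \<le> u i \<and> u i \<le> v i \<and> v i \<le> b) \<and>
      disjoint_family_on (\<lambda>i. {u i<..<v i}) {..<n} \<and> (\<Sum>i<n. v i - u i) < e / (L + 1)"
    have "(\<Sum>i<n. \<bar>f (v i) - f (u i)\<bar>) \<le> (\<Sum>i<n. L * (v i - u i))"
    proof (rule sum_mono)
      fix i assume "i \<in> {..<n}"
      then show "\<bar>f (v i) - f (u i)\<bar> \<le> L * (v i - u i)"
        using lipschitz_onD[OF assms, of "v i" "u i"] * by (auto simp: dist_real_def)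
    qed
    also have "\<dots> = L * (\<Sum>i<n. v i - u i)" by (simp add: sum_distrib_left)
    also have "\<dots> \<le> (L + 1) * (\<Sum>i<n. v i - u i)"
      using * by (intro mult_right_mono sum_nonneg) auto
    also have "\<dots> < e" using * L by (auto simp: field_simps)
    finally show "(\<Sum>i<n. \<bar>f (v i) - f (u i)\<bar>) < e" .
  qed
qed

text \<open>A Lipschitz function is itself an absolutely continuous curve, so this is the case \<open>g = 1\<close> of
  \<open>curve_integral_ge\<close>.\<close>
lemma lipschitz_increment_le_integral_deriv:
  fixes f :: "real \<Rightarrow> real"
  assumes "L-lipschitz_on UNIV f" "a \<le> b"
  shows "ennreal \<bar>f b - f a\<bar> \<le> (\<integral>\<^sup>+x\<in>{a..b}. ennreal \<bar>deriv f x\<bar> \<partial>lborel)"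
proof -
  have "ennreal \<bar>f b - f a\<bar> = (\<integral>\<^sup>+y\<in>{min (f a) (f b)..max (f a) (f b)}. 1 \<partial>lborel)"
    by (simp add: min_def max_def)
  also have "\<dots> \<le> curve_integral (\<lambda>_. 1) (a, b, f)"
    using lipschitz_absolutely_continuous[OF assms(1)] assms(2) by (intro curve_integral_ge) auto
  finally show ?thesis by simp
qed

lemma lipschitz_derivative_bound:
  fixes f :: "real \<Rightarrow> real"
  assumes "L-lipschitz_on UNIV f" "(f has_real_derivative d) (at x)"
  shows "\<bar>d\<bar> \<le> L"
proof (rule tendsto_upperbound)
  show "((\<lambda>y. \<bar>(f y - f x) / (y - x)\<bar>) \<longlongrightarrow> \<bar>d\<bar>) (at x)"
    using assms(2) unfolding has_field_derivative_iff by (rule tendsto_rabs)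
  have "\<bar>(f y - f x) / (y - x)\<bar> \<le> L" for y
    using lipschitz_onD[OF assms(1), of y x] lipschitz_on_nonneg[OF assms(1)]
    by (cases "y = x") (auto simp: dist_real_def abs_divide field_simps)
  then show "\<forall>\<^sub>F y in at x. \<bar>(f y - f x) / (y - x)\<bar> \<le> L" by simp
qed simp

text \<open>Suppose that \<open>g \<le> \<alpha> < \<beta> < \<bar>D\<bar>\<close> on \<open>E\<close>. Near points of \<open>E\<close> short intervals satisfy
  \<open>\<beta> * length \<le> \<bar>increment of f\<bar> \<le> \<integral> g\<close>, so the comparison principle gives
  \<open>\<beta> * \<lambda>(E) \<le> \<integral>\<^sub>U g\<close> for every open \<open>U \<supseteq> E\<close>. Outer regularity of the finite measure \<open>g \<lambda>\<close> on \<open>J\<close>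
  replaces \<open>U\<close> by \<open>E\<close>, where the integral is at most \<open>\<alpha> * \<lambda>(E)\<close>. Hence \<open>\<lambda>(E) = 0\<close>.\<close>
theorem derivative_le_of_increment_le_integral:
  fixes f D :: "real \<Rightarrow> real" and g :: "real \<Rightarrow> ennreal"
  assumes J: "open J" and g[measurable]: "g \<in> borel_measurable borel" and D[measurable]: "D \<in> borel_measurable borel"
    and fin: "(\<integral>\<^sup>+x\<in>J. g x \<partial>lborel) < \<infinity>"
    and incr: "\<And>u v. u < v \<Longrightarrow> {u..v} \<subseteq> J \<Longrightarrow> ennreal \<bar>f v - f u\<bar> \<le> (\<integral>\<^sup>+x\<in>{u..v}. g x \<partial>lborel)"
    and deriv: "AE x in lborel. (f has_real_derivative D x) (at x)"
  shows "AE x in lborel. x \<in> J \<longrightarrow> ennreal \<bar>D x\<bar> \<le> g x"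
proof -
  obtain B where B: "{x. \<not> (f has_real_derivative D x) (at x)} \<subseteq> B" "B \<in> null_sets lborel"
    using deriv by (auto simp: eventually_ae_filter)
  then have [measurable]: "B \<in> sets borel" by auto
  have [measurable]: "J \<in> sets borel" using J by auto
  define M where "M = density lborel (\<lambda>x. g x * indicator J x)"
  have M: "sets M = sets borel" by (simp add: M_def)
  have Mfin: "emeasure M (space M) \<noteq> \<infinity>" using fin by (simp add: M_def emeasure_density)
  define E where "E = (\<lambda>(\<alpha>, \<beta>). {x \<in> J - B. g x \<le> ennreal \<alpha> \<and> \<beta> < \<bar>D x\<bar>})"
  have [measurable]: "E i \<in> sets borel" for i unfolding E_def by (cases i) simp
  have null: "E (\<alpha>, \<beta>) \<in> null_sets lborel" if \<alpha>\<beta>: "0 \<le> \<alpha>" "\<alpha> < \<beta>" for \<alpha> \<beta>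
  proof -
    let ?E = "E (\<alpha>, \<beta>)"
    have le: "ennreal \<beta> * emeasure lborel ?E \<le> emeasure M U" if U: "open U" "?E \<subseteq> U" for U
    proof -
      have UJ: "open (U \<inter> J)" "?E \<subseteq> U \<inter> J" using U J by (auto simp: E_def)
      obtain G where G: "open G" "G \<subseteq> U \<inter> J" "negligible (?E - G)"
        "emeasure (density lborel (\<lambda>_. ennreal \<beta>)) G \<le> emeasure M G"
      proof (rule Vitali_measure_compare[OF _ M UJ, of "density lborel (\<lambda>_. ennreal \<beta>)"])
        fix x d :: real assume x: "x \<in> ?E" "d > 0"
        then have "x \<in> J" by (auto simp: E_def)
        then obtain e where e: "e > 0" "ball x e \<subseteq> J" using J open_contains_ball by blast
        have "(f has_real_derivative D x) (at x)" "\<beta> < \<bar>D x\<bar>" using x B by (auto simp: E_def)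
        then have "((\<lambda>y. \<bar>(f y - f x) / (y - x)\<bar>) \<longlongrightarrow> \<bar>D x\<bar>) (at x)"
          unfolding has_field_derivative_iff by (intro tendsto_rabs)
        then have "eventually (\<lambda>y. \<beta> < \<bar>(f y - f x) / (y - x)\<bar>) (at x)"
          using \<open>\<beta> < \<bar>D x\<bar>\<close> by (rule order_tendstoD)
        then obtain s where s: "s > 0" "\<And>y. y \<noteq> x \<Longrightarrow> dist y x < s \<Longrightarrow> \<beta> < \<bar>(f y - f x) / (y - x)\<bar>"
          by (auto simp: eventually_at)
        define t where "t = min (min d e) s / 2"
        have t: "t > 0" "t < d" "t < e" "t < s" using x e s by (auto simp: t_def)
        have "\<beta> < \<bar>f (x + t) - f x\<bar> / t"
          using s(2)[of "x + t"] t by (simp add: dist_real_def abs_divide)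
        then have "\<beta> * t \<le> \<bar>f (x + t) - f x\<bar>" using t by (simp add: field_simps)
        then have "ennreal \<beta> * ennreal t \<le> ennreal \<bar>f (x + t) - f x\<bar>"
          using \<alpha>\<beta> t by (simp add: ennreal_mult[symmetric] ennreal_leI)
        also have "\<dots> \<le> (\<integral>\<^sup>+y\<in>{x..x + t}. g y \<partial>lborel)"
          using e t by (intro incr) (auto simp: subset_eq dist_real_def)
        also have "\<dots> = (\<integral>\<^sup>+y. g y * indicator J y * indicator {x<..<x + t} y \<partial>lborel)"
        proof (rule nn_integral_cong_AE)
          have "AE y in lborel. y \<noteq> x" "AE y in lborel. y \<noteq> x + t" by (rule AE_lborel_singleton)+
          then show "AE y in lborel. g y * indicator {x..x + t} y = g y * indicator J y * indicator {x<..<x + t} y"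
          proof eventually_elim
            case (elim y)
            then show ?case using e t by (auto simp: indicator_def subset_eq dist_real_def)
          qed
        qed
        also have "\<dots> = emeasure M {x<..<x + t}" by (simp add: M_def emeasure_density)
        finally show "\<exists>u v. u \<le> x \<and> x \<le> v \<and> u < v \<and> v - u < d \<and>
            emeasure (density lborel (\<lambda>_. ennreal \<beta>)) {u<..<v} \<le> emeasure M {u<..<v}"
          using t by (intro exI[of _ x] exI[of _ "x + t"]) (auto simp: emeasure_density_const)
      qed auto
      have "ennreal \<beta> * emeasure lborel ?E \<le> ennreal \<beta> * emeasure lborel G"
        using outer_lebesgue_le[of ?E G] G by (intro mult_left_mono) auto
      also have "\<dots> \<le> emeasure M G" using G by (simp add: emeasure_density_const)
      also have "\<dots> \<le> emeasure M U" using G U M by (intro emeasure_mono) auto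
      finally show ?thesis .
    qed
    have "ennreal \<beta> * emeasure lborel ?E \<le> (INF U\<in>{U. ?E \<subseteq> U \<and> open U}. emeasure M U)"
      using le by (intro INF_greatest) auto
    also have "\<dots> = emeasure M ?E" by (rule outer_regular[OF M Mfin, symmetric]) simp
    finally have 1: "ennreal \<beta> * emeasure lborel ?E \<le> emeasure M ?E" .
    have "emeasure M ?E = (\<integral>\<^sup>+x. g x * indicator J x * indicator ?E x \<partial>lborel)"
      by (simp add: M_def emeasure_density)
    also have "\<dots> \<le> (\<integral>\<^sup>+x. ennreal \<alpha> * indicator ?E x \<partial>lborel)"
      by (intro nn_integral_mono) (auto simp: indicator_def E_def)
    also have "\<dots> = ennreal \<alpha> * emeasure lborel ?E" by (simp add: nn_integral_cmult_indicator)
    finally have 2: "emeasure M ?E \<le> ennreal \<alpha> * emeasure lborel ?E" .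
    have "emeasure lborel ?E \<noteq> \<infinity>"
    proof
      assume "emeasure lborel ?E = \<infinity>"
      then have "emeasure M ?E = \<infinity>" using 1 \<alpha>\<beta> by (simp add: ennreal_mult_top top_unique)
      moreover have "emeasure M ?E \<le> emeasure M (space M)" by (rule emeasure_space)
      ultimately show False using Mfin by (simp add: top_unique)
    qed
    then obtain m where m: "emeasure lborel ?E = ennreal m" "m \<ge> 0"
      by (cases "emeasure lborel ?E") auto
    have "ennreal (\<beta> * m) \<le> ennreal (\<alpha> * m)"
      using order_trans[OF 1 2] m \<alpha>\<beta> by (simp add: ennreal_mult)
    then have "\<beta> * m \<le> \<alpha> * m" using m \<alpha>\<beta> by (simp add: ennreal_le_iff)
    then have "m = 0" using m \<alpha>\<beta> mult_strict_right_mono[of \<alpha> \<beta> m] by (cases "m = 0") auto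
    then show ?thesis using m by (simp add: null_sets_def)
  qed
  define I where "I = {(\<alpha>, \<beta>). \<alpha> \<in> \<rat> \<and> \<beta> \<in> \<rat> \<and> 0 \<le> \<alpha> \<and> \<alpha> < (\<beta>::real)}"
  have "I \<subseteq> \<rat> \<times> \<rat>" by (auto simp: I_def)
  then have "countable I" by (rule countable_subset) (intro countable_SIGMA countable_rat)
  then have "(\<Union>i\<in>I. E i) \<in> null_sets lborel"
    by (rule null_sets_UN') (use null in \<open>auto simp: I_def\<close>)
  then have "B \<union> (\<Union>i\<in>I. E i) \<in> null_sets lborel" using B by blast
  then show ?thesis
  proof (rule AE_I')
    show "{x \<in> space lborel. \<not> (x \<in> J \<longrightarrow> ennreal \<bar>D x\<bar> \<le> g x)} \<subseteq> B \<union> (\<Union>i\<in>I. E i)"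
    proof
      fix x assume "x \<in> {x \<in> space lborel. \<not> (x \<in> J \<longrightarrow> ennreal \<bar>D x\<bar> \<le> g x)}"
      then have x: "x \<in> J" "g x < ennreal \<bar>D x\<bar>" by auto
      then obtain t where t: "g x = ennreal t" "t \<ge> 0" by (cases "g x") auto
      then have "t < \<bar>D x\<bar>" using x by (simp add: ennreal_less_iff)
      then obtain \<alpha> where \<alpha>: "\<alpha> \<in> \<rat>" "t < \<alpha>" "\<alpha> < \<bar>D x\<bar>" using Rats_dense_in_real by blast
      then obtain \<beta> where \<beta>: "\<beta> \<in> \<rat>" "\<alpha> < \<beta>" "\<beta> < \<bar>D x\<bar>" using Rats_dense_in_real by blast
      have "(\<alpha>, \<beta>) \<in> I" using \<alpha> \<beta> t by (auto simp: I_def)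
      moreover have "x \<in> E (\<alpha>, \<beta>)" if "x \<notin> B"
        using that x \<alpha> \<beta> t by (auto simp: E_def intro!: ennreal_leI)
      ultimately show "x \<in> B \<union> (\<Union>i\<in>I. E i)" by blast
    qed
  qed
qed

section \<open>Modulus of curve families\<close>

lemma epowr_borel [measurable]:
  assumes [measurable]: "h \<in> borel_measurable M"
  shows "(\<lambda>x. epowr (h x) p) \<in> borel_measurable M"
  unfolding epowr_def by measurable

lemma epowr_mono:
  assumes "x \<le> y" "p > 0"
  shows "epowr x p \<le> epowr y p"
proof (cases "y = \<infinity>")
  case False
  then have "x \<noteq> \<infinity>" using assms by (auto simp: top_unique)
  then show ?thesis using False assms
    by (auto simp: epowr_def less_top intro!: ennreal_leI powr_mono2 enn2real_mono)
qed (simp add: epowr_def)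

lemma epowr_inverse:
  assumes "p > 0"
  shows "epowr (epowr x p) (1 / p) = x"
  using assms by (cases "x = \<infinity>") (auto simp: epowr_def powr_powr less_top)

lemma epowr_0 [simp]: "epowr 0 p = 0"
  by (simp add: epowr_def)

text \<open>The supremum need not be attained, so the bound goes through the monotone inverse \<open>epowr _ (1 / p)\<close>.\<close>
lemma epowr_SUP_le:
  assumes p: "p > 0"
  shows "epowr (SUP n::nat. g n) p \<le> (\<Sum>n. epowr (g n) p)"
proof -
  let ?s = "\<Sum>n. epowr (g n) p"
  have "g n \<le> epowr ?s (1 / p)" for n
  proof -
    have "epowr (g n) p \<le> ?s" using sum_le_suminf[of "\<lambda>n. epowr (g n) p" "{n}"] by simp
    then have "epowr (epowr (g n) p) (1 / p) \<le> epowr ?s (1 / p)" using p by (intro epowr_mono) auto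
    then show ?thesis by (simp add: epowr_inverse[OF p])
  qed
  then have "(SUP n. g n) \<le> epowr ?s (1 / p)" by (intro SUP_least)
  then have "epowr (SUP n. g n) p \<le> epowr (epowr ?s (1 / p)) p" using p by (intro epowr_mono)
  also have "\<dots> = ?s" using epowr_inverse[of "1 / p" ?s] p by simp
  finally show ?thesis .
qed

lemma curve_integral_mono:
  assumes "\<And>x. g x \<le> h x"
  shows "curve_integral g c \<le> curve_integral h c"
proof (cases c)
  case (fields a b \<gamma>)
  then show ?thesis using assms
    by (auto intro!: nn_integral_mono mult_right_mono)
qed

lemma Modulus_mono: "\<Gamma> \<subseteq> \<Gamma>' \<Longrightarrow> Modulus p \<mu> \<Gamma> \<le> Modulus p \<mu> \<Gamma>'"
  unfolding Modulus_def by (intro INF_superset_mono) auto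

lemma Modulus_le:
  assumes "g \<in> borel_measurable borel" "\<And>c. c \<in> \<Gamma> \<Longrightarrow> 1 \<le> curve_integral g c"
  shows "Modulus p \<mu> \<Gamma> \<le> (\<integral>\<^sup>+x. epowr (g x) p \<partial>\<mu>)"
  unfolding Modulus_def using assms by (intro INF_lower) auto

text \<open>If \<open>g n\<close> is admissible for \<open>\<Gamma> n\<close>, then the supremum of the \<open>g n\<close> is admissible for the union, and its cost is
  at most the sum of the costs, which can be made a geometric series with sum \<open>e\<close>.\<close>
lemma Modulus_null_nat_UN:
  assumes \<mu>: "sets \<mu> = sets borel" and p: "p > 0" and null: "\<And>n::nat. Modulus p \<mu> (\<Gamma> n) = 0"
  shows "Modulus p \<mu> (\<Union>n. \<Gamma> n) = 0"
proof -
  note [measurable_cong] = \<mu>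
  have *: "Modulus p \<mu> (\<Union>n. \<Gamma> n) \<le> 0 + ennreal e" if e: "e > 0" for e
  proof -
    have "\<exists>g. g \<in> borel_measurable borel \<and> (\<forall>c\<in>\<Gamma> n. 1 \<le> curve_integral g c) \<and>
        (\<integral>\<^sup>+x. epowr (g x) p \<partial>\<mu>) < ennreal (e * (1/2) ^ Suc n)" for n
    proof -
      have "Modulus p \<mu> (\<Gamma> n) < ennreal (e * (1/2) ^ Suc n)" using e by (simp add: null)
      then show ?thesis unfolding Modulus_def INF_less_iff by blast
    qed
    then obtain g where g: "\<And>n. g n \<in> borel_measurable borel" "\<And>n c. c \<in> \<Gamma> n \<Longrightarrow> 1 \<le> curve_integral (g n) c"
        "\<And>n. (\<integral>\<^sup>+x. epowr (g n x) p \<partial>\<mu>) < ennreal (e * (1/2) ^ Suc n)" by metis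
    note [measurable] = g(1)
    have "Modulus p \<mu> (\<Union>n. \<Gamma> n) \<le> (\<integral>\<^sup>+x. epowr (SUP n. g n x) p \<partial>\<mu>)"
    proof (rule Modulus_le)
      fix c assume "c \<in> (\<Union>n. \<Gamma> n)"
      then obtain n where "c \<in> \<Gamma> n" by blast
      then have "1 \<le> curve_integral (g n) c" by (rule g)
      also have "\<dots> \<le> curve_integral (\<lambda>x. SUP n. g n x) c"
        by (intro curve_integral_mono SUP_upper) simp
      finally show "1 \<le> curve_integral (\<lambda>x. SUP n. g n x) c" .
    qed measurable
    also have "\<dots> \<le> (\<integral>\<^sup>+x. (\<Sum>n. epowr (g n x) p) \<partial>\<mu>)"
      by (intro nn_integral_mono epowr_SUP_le p)
    also have "\<dots> = (\<Sum>n. (\<integral>\<^sup>+x. epowr (g n x) p \<partial>\<mu>))"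
      by (intro nn_integral_suminf) measurable
    also have "\<dots> \<le> (\<Sum>n. ennreal (e * (1/2) ^ Suc n))"
      by (intro suminf_le less_imp_le[OF g(3)] summableI)
    also have "\<dots> = ennreal e"
    proof (rule suminf_ennreal_eq)
      show "(\<lambda>n. e * (1/2) ^ Suc n) sums e" using sums_mult[OF power_half_series, of e] by simp
    qed (use e in simp)
    finally show ?thesis by simp
  qed
  have "Modulus p \<mu> (\<Union>n. \<Gamma> n) \<le> 0" by (rule ennreal_le_epsilon) (rule *)
  then show ?thesis by simp
qed

lemma Modulus_null_UN:
  assumes \<mu>: "sets \<mu> = sets borel" and p: "p > 0" and I: "countable I"
    and null: "\<And>i. i \<in> I \<Longrightarrow> Modulus p \<mu> (\<Gamma> i) = 0"
  shows "Modulus p \<mu> (\<Union>i\<in>I. \<Gamma> i) = 0"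
proof (cases "I = {}")
  case True
  have "Modulus p \<mu> {} \<le> (\<integral>\<^sup>+x. epowr 0 p \<partial>\<mu>)" by (rule Modulus_le) auto
  then show ?thesis using True by simp
next
  case False
  have "(\<Union>i\<in>I. \<Gamma> i) = (\<Union>n. \<Gamma> (from_nat_into I n))"
    using range_from_nat_into[OF False I] by (metis image_image)
  then show ?thesis
    using Modulus_null_nat_UN[OF \<mu> p, of "\<lambda>n. \<Gamma> (from_nat_into I n)"] null from_nat_into[OF False] by simp
qed

lemma dual_weight_borel [measurable]:
  assumes [measurable]: "w \<in> borel_measurable borel"
  shows "dual_weight p w \<in> borel_measurable borel"
  unfolding dual_weight_def[abs_def] by measurable

text \<open>A weak form of Young's inequality with its constants dropped. Either \<open>h\<close> is below \<open>\<epsilon>\<close> times the dual weight, or the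
  dual weight is below \<open>h / \<epsilon>\<close>; as \<open>w\<close> is the dual weight to the negative power \<open>1 - p\<close>, the latter bounds \<open>w\<close>
  from below. It replaces the inequality of Hoelder in all estimates.\<close>
lemma dual_weight_Young:
  assumes p: "p > 1" and w: "w x \<ge> 0" and \<epsilon>: "\<epsilon> > 0"
  shows "h \<le> ennreal \<epsilon> * dual_weight p w x + ennreal (\<epsilon> powr (1 - p)) * (epowr h p * ennreal (w x))"
proof (cases "w x = 0")
  case True
  then show ?thesis using \<epsilon> by (simp add: dual_weight_def ennreal_mult_top)
next
  case False
  then have w: "w x > 0" using w by simp
  define r where "r = w x powr (1 / (1 - p))"
  have r: "r > 0" "dual_weight p w x = ennreal r" "r powr (1 - p) = w x"
    using w p by (auto simp: r_def dual_weight_def powr_powr)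
  show ?thesis
  proof (cases "h = \<infinity>")
    case True
    then show ?thesis using w \<epsilon> by (simp add: epowr_def ennreal_mult_top ennreal_top_mult)
  next
    case False
    then obtain y where y: "h = ennreal y" "y \<ge> 0" by (cases h) auto
    show ?thesis
    proof (cases "y \<le> \<epsilon> * r")
      case True
      then have "h \<le> ennreal \<epsilon> * dual_weight p w x"
        using y r \<epsilon> by (simp add: ennreal_mult[symmetric] ennreal_leI)
      then show ?thesis by (simp add: add_increasing2)
    next
      case False
      then have ypos: "y > 0" "r < y / \<epsilon>" using \<epsilon> r by (auto simp: field_simps intro: le_less_trans[of 0 "\<epsilon> * r"])
      have "(y / \<epsilon>) powr (1 - p) \<le> r powr (1 - p)"
        using ypos r p by (intro powr_mono2') auto
      then have "y powr (1 - p) / \<epsilon> powr (1 - p) \<le> w x"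
        using ypos \<epsilon> r by (simp add: powr_divide)
      then have "y powr (1 - p) \<le> \<epsilon> powr (1 - p) * w x"
        using \<epsilon> by (simp add: field_simps)
      then have "y powr p * y powr (1 - p) \<le> y powr p * (\<epsilon> powr (1 - p) * w x)"
        by (rule mult_left_mono) simp
      also have "y powr p * y powr (1 - p) = y" using ypos by (simp add: powr_add[symmetric])
      finally have "ennreal y \<le> ennreal (\<epsilon> powr (1 - p) * (y powr p * w x))"
        by (intro ennreal_leI) (simp add: algebra_simps)
      also have "\<dots> = ennreal (\<epsilon> powr (1 - p)) * (epowr h p * ennreal (w x))"
        using w y by (simp add: epowr_def ennreal_mult)
      finally show ?thesis using y by (simp add: add_increasing)
    qed
  qed
qed

text \<open>The decomposition of \<open>\<mu>\<close> enters only through two properties of integrals: \<open>w\<close> times Lebesgue measure lies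
  below \<open>\<mu>\<close>, and agrees with it off a Lebesgue null Borel set \<open>B\<close>. Enlarging \<open>B\<close> by another null set is
  harmless, and in the application \<open>B\<close> also contains the points where \<open>f\<close> is not differentiable.\<close>
locale weighted_line =
  fixes p :: real and \<mu> :: "real measure" and w :: "real \<Rightarrow> real" and B :: "real set"
  assumes p: "p > 1"
    and sets_\<mu> [measurable_cong]: "sets \<mu> = sets borel"
    and w_borel [measurable]: "w \<in> borel_measurable borel" and w_nonneg: "\<And>x. w x \<ge> 0"
    and B_null: "B \<in> null_sets lborel"
    and weight_le: "\<And>h. h \<in> borel_measurable borel \<Longrightarrow> (\<integral>\<^sup>+x. h x * ennreal (w x) \<partial>lborel) \<le> (\<integral>\<^sup>+x. h x \<partial>\<mu>)"
    and weight_eq: "\<And>h. h \<in> borel_measurable borel \<Longrightarrow> (\<And>x. x \<in> B \<Longrightarrow> h x = 0) \<Longrightarrow>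
           (\<integral>\<^sup>+x. h x \<partial>\<mu>) = (\<integral>\<^sup>+x. h x * ennreal (w x) \<partial>lborel)"
begin

lemma B_borel [measurable]: "B \<in> sets borel"
  using B_null by auto

lemma integral_Young:
  assumes [measurable]: "h \<in> borel_measurable borel" "A \<in> sets borel" and \<epsilon>: "\<epsilon> > 0"
  shows "(\<integral>\<^sup>+x\<in>A. h x \<partial>lborel) \<le> ennreal \<epsilon> * (\<integral>\<^sup>+x\<in>A. dual_weight p w x \<partial>lborel)
      + ennreal (\<epsilon> powr (1 - p)) * (\<integral>\<^sup>+x\<in>A. epowr (h x) p \<partial>\<mu>)"
proof -
  have "(\<integral>\<^sup>+x\<in>A. h x \<partial>lborel) \<le> (\<integral>\<^sup>+x. ennreal \<epsilon> * (dual_weight p w x * indicator A x) +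
       ennreal (\<epsilon> powr (1 - p)) * ((epowr (h x) p * indicator A x) * ennreal (w x)) \<partial>lborel)"
    by (intro nn_integral_mono)
       (use dual_weight_Young[where w = w, OF p w_nonneg \<epsilon>] in \<open>auto simp: indicator_def\<close>)
  also have "\<dots> = ennreal \<epsilon> * (\<integral>\<^sup>+x\<in>A. dual_weight p w x \<partial>lborel)
      + ennreal (\<epsilon> powr (1 - p)) * (\<integral>\<^sup>+x. (epowr (h x) p * indicator A x) * ennreal (w x) \<partial>lborel)"
    by (subst nn_integral_add) (auto simp: nn_integral_cmult)
  also have "\<dots> \<le> ennreal \<epsilon> * (\<integral>\<^sup>+x\<in>A. dual_weight p w x \<partial>lborel)
      + ennreal (\<epsilon> powr (1 - p)) * (\<integral>\<^sup>+x\<in>A. epowr (h x) p \<partial>\<mu>)"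
    by (intro add_left_mono mult_left_mono weight_le) auto
  finally show ?thesis .
qed

text \<open>With \<open>\<epsilon>\<close> so small that the dual weight contributes at most one half, Young's inequality
  forces every admissible density to cost at least \<open>1 / (2 * \<kappa>)\<close>.\<close>
lemma Modulus_segment_pos:
  assumes ab: "a < b" and fin: "(\<integral>\<^sup>+x\<in>{a..b}. dual_weight p w x \<partial>lborel) < \<infinity>"
  shows "Modulus p \<mu> {(a, b, \<lambda>x. x)} \<noteq> 0"
proof -
  obtain m where m: "(\<integral>\<^sup>+x\<in>{a..b}. dual_weight p w x \<partial>lborel) = ennreal m" "m \<ge> 0"
    using fin by (cases "\<integral>\<^sup>+x\<in>{a..b}. dual_weight p w x \<partial>lborel") auto
  define \<epsilon> where "\<epsilon> = 1 / (2 * (m + 1))"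
  have \<epsilon>: "\<epsilon> > 0" "\<epsilon> * m \<le> 1 / 2" using m by (auto simp: \<epsilon>_def field_simps)
  have "ennreal \<epsilon> * ennreal m = ennreal (\<epsilon> * m)" using \<epsilon> m by (simp add: ennreal_mult)
  then have half: "ennreal \<epsilon> * ennreal m \<le> ennreal (1 / 2)" using ennreal_leI[OF \<epsilon>(2)] by (simp only:)
  define \<kappa> where "\<kappa> = \<epsilon> powr (1 - p)"
  have \<kappa>: "\<kappa> > 0" using \<epsilon> by (simp add: \<kappa>_def)
  have "ennreal (1 / (2 * \<kappa>)) \<le> Modulus p \<mu> {(a, b, \<lambda>x. x)}"
    unfolding Modulus_def
  proof (rule INF_greatest)
    fix g assume "g \<in> {g \<in> borel_measurable borel. \<forall>c\<in>{(a, b, \<lambda>x. x)}. 1 \<le> curve_integral g c}"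
    then have [measurable]: "g \<in> borel_measurable borel" and "1 \<le> (\<integral>\<^sup>+x\<in>{a..b}. g x \<partial>lborel)" by auto
    note this(2)
    also have "(\<integral>\<^sup>+x\<in>{a..b}. g x \<partial>lborel) \<le> ennreal \<epsilon> * ennreal m + ennreal \<kappa> * (\<integral>\<^sup>+x\<in>{a..b}. epowr (g x) p \<partial>\<mu>)"
      using integral_Young[of g "{a..b}" \<epsilon>] \<epsilon> by (simp add: m \<kappa>_def)
    also have "\<dots> \<le> ennreal (1 / 2) + ennreal \<kappa> * (\<integral>\<^sup>+x. epowr (g x) p \<partial>\<mu>)"
      by (intro add_mono half mult_left_mono nn_integral_mono) (auto simp: indicator_def)
    finally have *: "1 \<le> ennreal (1 / 2) + ennreal \<kappa> * (\<integral>\<^sup>+x. epowr (g x) p \<partial>\<mu>)" .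
    show "ennreal (1 / (2 * \<kappa>)) \<le> (\<integral>\<^sup>+x. epowr (g x) p \<partial>\<mu>)"
    proof (cases "\<integral>\<^sup>+x. epowr (g x) p \<partial>\<mu>")
      case (real y)
      have "ennreal 1 \<le> ennreal (1 / 2 + \<kappa> * y)"
        using * real \<kappa> by (simp add: ennreal_mult ennreal_plus)
      then have "1 / 2 \<le> \<kappa> * y" using real \<kappa> by (subst (asm) ennreal_le_iff) auto
      then have "1 / (2 * \<kappa>) \<le> y" using \<kappa> by (simp add: field_simps)
      then show ?thesis using real by (simp add: ennreal_leI)
    qed simp
  qed
  moreover have "ennreal (1 / (2 * \<kappa>)) > 0" using \<kappa> by simp
  ultimately show ?thesis by auto
qed

text \<open>Converse of the previous estimate. If \<open>w\<close> vanishes on a set of positive measure, the value \<open>\<infinity>\<close> on this set is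
  free. Otherwise \<open>r = w powr (1 / (1 - p))\<close> is finite almost everywhere; truncated to the set \<open>A k\<close> where
  \<open>r \<le> k\<close> and divided by its integral \<open>c\<close> it has integral one, and since \<open>r powr p * w = r\<close> its cost is
  \<open>c powr (1 - p)\<close>. This tends to \<open>0\<close> because \<open>c\<close> tends to \<open>\<infinity>\<close> with \<open>k\<close>.\<close>
lemma cheap_density:
  assumes inf: "(\<integral>\<^sup>+x\<in>{u<..<v}. dual_weight p w x \<partial>lborel) = \<infinity>" and uv: "u < v" and \<epsilon>: "\<epsilon> > 0"
  obtains h where "h \<in> borel_measurable borel" "1 \<le> (\<integral>\<^sup>+x\<in>{u<..<v}. h x \<partial>lborel)"
    "(\<integral>\<^sup>+x. epowr (h x) p \<partial>\<mu>) \<le> ennreal \<epsilon>"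
proof -
  define Z where "Z = {x \<in> {u<..<v} - B. w x = 0}"
  have [measurable]: "Z \<in> sets borel" unfolding Z_def by measurable
  show ?thesis
  proof (cases "emeasure lborel Z = 0")
    case False
    define h where "h = (\<lambda>x. (\<infinity> :: ennreal) * indicator Z x)"
    have [measurable]: "h \<in> borel_measurable borel" by (simp add: h_def)
    show ?thesis
    proof (rule that[of h])
      have "(\<integral>\<^sup>+x\<in>{u<..<v}. h x \<partial>lborel) = (\<integral>\<^sup>+x. \<infinity> * indicator Z x \<partial>lborel)"
        by (intro nn_integral_cong) (auto simp: h_def Z_def indicator_def)
      also have "\<dots> = \<infinity> * emeasure lborel Z" by (rule nn_integral_cmult_indicator) simp
      also have "\<dots> = \<infinity>" using False by (simp add: ennreal_top_mult)
      finally show "1 \<le> (\<integral>\<^sup>+x\<in>{u<..<v}. h x \<partial>lborel)" by simp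
      have "(\<integral>\<^sup>+x. epowr (h x) p \<partial>\<mu>) = (\<integral>\<^sup>+x. epowr (h x) p * ennreal (w x) \<partial>lborel)"
        by (intro weight_eq) (auto simp: h_def Z_def)
      also have "\<dots> = (\<integral>\<^sup>+x. 0 \<partial>(lborel :: real measure))"
        by (intro nn_integral_cong) (auto simp: h_def Z_def indicator_def)
      finally show "(\<integral>\<^sup>+x. epowr (h x) p \<partial>\<mu>) \<le> ennreal \<epsilon>" by simp
    qed measurable
  next
    case True
    define r where "r = (\<lambda>x. w x powr (1 / (1 - p)))"
    have [measurable]: "r \<in> borel_measurable borel" unfolding r_def by measurable
    define A where "A = (\<lambda>k::nat. {x \<in> {u<..<v} - B. w x > 0 \<and> r x \<le> real k})"
    have [measurable]: "A k \<in> sets borel" for k unfolding A_def by measurable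
    define m where "m = (\<lambda>k. \<integral>\<^sup>+x\<in>A k. ennreal (r x) \<partial>lborel)"
    have "(SUP k. m k) = (\<integral>\<^sup>+x. (SUP k. ennreal (r x) * indicator (A k) x) \<partial>lborel)"
      unfolding m_def
      by (intro nn_integral_monotone_convergence_SUP[symmetric])
         (auto simp: incseq_def le_fun_def indicator_def A_def)
    also have "\<dots> = (\<integral>\<^sup>+x\<in>{u<..<v}. dual_weight p w x \<partial>lborel)"
    proof (rule nn_integral_cong_AE)
      have "Z \<in> null_sets lborel" using True by (auto simp: null_sets_def)
      then have "AE x in lborel. x \<notin> Z" by (rule AE_not_in)
      moreover have "AE x in lborel. x \<notin> B" using B_null by (rule AE_not_in)
      ultimately show "AE x in lborel. (SUP k. ennreal (r x) * indicator (A k) x) = dual_weight p w x * indicator {u<..<v} x"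
      proof eventually_elim
        case (elim x)
        show ?case
        proof (cases "x \<in> {u<..<v}")
          case True
          then have wx: "w x > 0" using elim w_nonneg[of x] by (auto simp: Z_def)
          obtain k :: nat where "r x \<le> real k" using real_arch_simple by blast
          then have "x \<in> A k" using True elim wx by (auto simp: A_def)
          then have "(SUP k. ennreal (r x) * indicator (A k) x) = ennreal (r x)"
            by (intro antisym SUP_least SUP_upper2[of k]) (auto simp: indicator_def)
          then show ?thesis using True wx by (simp add: dual_weight_def r_def)
        next
          case False
          then have "x \<notin> A k" for k by (auto simp: A_def)
          then show ?thesis using False by simp
        qed
      qed
    qed
    finally have sup: "(SUP k. m k) = \<infinity>" using inf by simp
    \<comment> \<open>The size of \<open>c\<close> at which the cost \<open>c powr (1 - p)\<close> reaches \<open>\<epsilon>\<close>.\<close>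
    define M where "M = \<epsilon> powr (1 / (1 - p))"
    have M: "M > 0" "M powr (1 - p) = \<epsilon>" using \<epsilon> p by (auto simp: M_def powr_powr)
    have "ennreal M < (SUP k. m k)" by (simp add: sup)
    then obtain k where k: "ennreal M < m k" by (auto simp: less_SUP_iff)
    have "m k \<le> (\<integral>\<^sup>+x. ennreal (real k) * indicator {u<..<v} x \<partial>lborel)"
      unfolding m_def by (intro nn_integral_mono) (auto simp: A_def indicator_def intro!: ennreal_leI)
    also have "\<dots> < \<infinity>" using uv by (simp add: nn_integral_cmult_indicator ennreal_mult[symmetric])
    finally obtain c where c: "m k = ennreal c" "c \<ge> 0" by (cases "m k") auto
    then have cM: "c > M" using k M by (simp add: ennreal_less_iff)
    then have c_pos: "c > 0" using M by simp
    define h where "h = (\<lambda>x. ennreal (r x / c) * indicator (A k) x)"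
    have [measurable]: "h \<in> borel_measurable borel" by (simp add: h_def)
    have r0: "r x \<ge> 0" for x by (simp add: r_def)
    show ?thesis
    proof (rule that[of h])
      have "(\<integral>\<^sup>+x\<in>{u<..<v}. h x \<partial>lborel) = (\<integral>\<^sup>+x. ennreal (1 / c) * (ennreal (r x) * indicator (A k) x) \<partial>lborel)"
        using c_pos r0 by (intro nn_integral_cong)
          (auto simp: h_def A_def indicator_def ennreal_mult[symmetric])
      also have "\<dots> = ennreal (1 / c) * m k" by (simp add: nn_integral_cmult m_def)
      also have "\<dots> = 1" using c c_pos by (simp add: ennreal_mult[symmetric])
      finally show "1 \<le> (\<integral>\<^sup>+x\<in>{u<..<v}. h x \<partial>lborel)" by simp
      have "(\<integral>\<^sup>+x. epowr (h x) p \<partial>\<mu>) = (\<integral>\<^sup>+x. epowr (h x) p * ennreal (w x) \<partial>lborel)"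
        by (intro weight_eq) (auto simp: h_def A_def)
      also have "\<dots> = (\<integral>\<^sup>+x. ennreal (c powr (- p)) * (ennreal (r x) * indicator (A k) x) \<partial>lborel)"
      proof (rule nn_integral_cong)
        fix x
        show "epowr (h x) p * ennreal (w x) = ennreal (c powr (- p)) * (ennreal (r x) * indicator (A k) x)"
        proof (cases "x \<in> A k")
          case True
          then have wx: "w x > 0" by (simp add: A_def)
          have "r x powr p * w x = w x powr (1 / (1 - p) * p) * w x powr 1"
            using wx by (simp add: r_def powr_powr)
          also have "\<dots> = w x powr (1 / (1 - p) * p + 1)" by (simp only: powr_add)
          also have "1 / (1 - p) * p + 1 = 1 / (1 - p)" using p by (simp add: field_simps)
          finally have "r x powr p * w x = r x" by (simp add: r_def)
          then have "(r x / c) powr p * w x = c powr (- p) * r x"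
            using c_pos r0[of x] by (simp add: powr_divide powr_minus field_simps)
          then show ?thesis using True r0[of x] c_pos wx
            by (simp add: h_def epowr_def ennreal_mult[symmetric])
        qed (simp add: h_def)
      qed
      also have "\<dots> = ennreal (c powr (- p)) * ennreal c" unfolding c(1)[symmetric] m_def by (rule nn_integral_cmult) measurable
      also have "\<dots> = ennreal (c powr (1 - p))"
        using c_pos by (simp add: ennreal_mult[symmetric] powr_diff powr_minus field_simps)
      also have "\<dots> \<le> ennreal (M powr (1 - p))"
        using M cM p by (intro ennreal_leI powr_mono2') auto
      finally show "(\<integral>\<^sup>+x. epowr (h x) p \<partial>\<mu>) \<le> ennreal \<epsilon>" by (simp add: M)
    qed measurable
  qed
qed

definition crossing :: "real \<Rightarrow> real \<Rightarrow> curve set" where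
  "crossing u v = {(a, b, \<gamma>) \<in> ac_curves. {u<..<v} \<subseteq> {min (\<gamma> a) (\<gamma> b)..max (\<gamma> a) (\<gamma> b)}}"

lemma Modulus_crossing_null:
  assumes inf: "(\<integral>\<^sup>+x\<in>{u<..<v}. dual_weight p w x \<partial>lborel) = \<infinity>" and uv: "u < v"
  shows "Modulus p \<mu> (crossing u v) = 0"
proof -
  have *: "Modulus p \<mu> (crossing u v) \<le> 0 + ennreal \<epsilon>" if \<epsilon>: "\<epsilon> > 0" for \<epsilon>
  proof -
    obtain h where h: "h \<in> borel_measurable borel" "1 \<le> (\<integral>\<^sup>+x\<in>{u<..<v}. h x \<partial>lborel)"
      "(\<integral>\<^sup>+x. epowr (h x) p \<partial>\<mu>) \<le> ennreal \<epsilon>"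
      using cheap_density[OF inf uv \<epsilon>] .
    have "Modulus p \<mu> (crossing u v) \<le> (\<integral>\<^sup>+x. epowr (h x) p \<partial>\<mu>)"
    proof (rule Modulus_le[OF h(1)])
      fix c assume "c \<in> crossing u v"
      then obtain a b \<gamma> where c: "c = (a, b, \<gamma>)" "a \<le> b" "absolutely_continuous_curve_on a b \<gamma>"
         "{u<..<v} \<subseteq> {min (\<gamma> a) (\<gamma> b)..max (\<gamma> a) (\<gamma> b)}"
        by (auto simp: crossing_def ac_curves_def)
      have "(\<integral>\<^sup>+x\<in>{u<..<v}. h x \<partial>lborel) \<le> (\<integral>\<^sup>+x\<in>{min (\<gamma> a) (\<gamma> b)..max (\<gamma> a) (\<gamma> b)}. h x \<partial>lborel)"
        using c(4) by (intro nn_integral_mono mult_left_mono) (auto simp: indicator_def)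
      also have "\<dots> \<le> curve_integral h c"
        unfolding c(1) by (rule curve_integral_ge[OF c(3,2) h(1)])
      finally show "1 \<le> curve_integral h c" using h(2) by simp
    qed
    then show ?thesis using h(3) by simp
  qed
  have "Modulus p \<mu> (crossing u v) \<le> 0" by (rule ennreal_le_epsilon) (rule *)
  then show ?thesis by simp
qed

end

section \<open>The gradient\<close>

lemma open_contains_rational_interval:
  assumes "open U" "(x::real) \<in> U"
  obtains u v where "u \<in> \<rat>" "v \<in> \<rat>" "u < x" "x < v" "{u..v} \<subseteq> U"
proof -
  obtain e where e: "e > 0" "ball x e \<subseteq> U" using assms open_contains_ball by blast
  obtain u where u: "u \<in> \<rat>" "x - e < u" "u < x" using Rats_dense_in_real[of "x - e" x] e by auto
  obtain v where v: "v \<in> \<rat>" "x < v" "v < x + e" using Rats_dense_in_real[of x "x + e"] e by auto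
  have "{u..v} \<subseteq> ball x e" using u v by (auto simp: dist_real_def)
  then show ?thesis using that u v e by blast
qed

lemma open_N_set: "open (N_set p w)"
proof -
  have "N_set p w = \<Union>{U. open U \<and> (\<integral>\<^sup>+y\<in>U. dual_weight p w y \<partial>lborel) < \<infinity>}"
    by (auto simp: N_set_def)
  then show ?thesis by (metis (mono_tags, lifting) mem_Collect_eq open_Union)
qed

text \<open>\<open>D\<close> is a Borel representative of the derivative of \<open>f\<close>; the unspecified values of \<open>deriv\<close> make it
  inconvenient to work with \<open>deriv f\<close> itself.\<close>
locale weighted_line_lipschitz = weighted_line +
  fixes f D :: "real \<Rightarrow> real" and L :: real
  assumes lip: "L-lipschitz_on UNIV f" and D_borel [measurable]: "D \<in> borel_measurable borel"
    and D: "\<And>x. x \<notin> B \<Longrightarrow> (f has_real_derivative D x) (at x)"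
    and loc_fin: "locally_finite_measure \<mu>"
begin

definition gradient :: "real \<Rightarrow> ennreal" where
  "gradient x = (if x \<in> N_set p w - B then ennreal \<bar>D x\<bar> else 0)"

lemma N_set_borel [measurable]: "N_set p w \<in> sets borel"
  using open_N_set by (rule borel_open)

lemma gradient_borel [measurable]: "gradient \<in> borel_measurable borel"
  unfolding gradient_def[abs_def] by measurable

lemma gradient_bound: "gradient x \<le> ennreal L"
  using lipschitz_derivative_bound[OF lip D, of x] by (auto simp: gradient_def intro: ennreal_leI)

lemma gradient_locally_integrable: "locally_p_integrable p \<mu> gradient"
  unfolding locally_p_integrable_def
proof
  fix x
  obtain U where U: "open U" "x \<in> U" "emeasure \<mu> U < \<infinity>"
    using loc_fin by (auto simp: locally_finite_measure_def)
  have [measurable]: "U \<in> sets \<mu>" using U sets_\<mu> by simp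
  have "(\<integral>\<^sup>+y\<in>U. epowr (gradient y) p \<partial>\<mu>) \<le> (\<integral>\<^sup>+y. epowr (ennreal L) p * indicator U y \<partial>\<mu>)"
    using p by (intro nn_integral_mono mult_right_mono epowr_mono gradient_bound) auto
  also have "\<dots> = epowr (ennreal L) p * emeasure \<mu> U" by (simp add: nn_integral_cmult_indicator)
  also have "\<dots> < \<infinity>" using U(3) by (auto simp: epowr_def ennreal_mult_less_top)
  finally show "\<exists>U. open U \<and> x \<in> U \<and> (\<integral>\<^sup>+y\<in>U. epowr (gradient y) p \<partial>\<mu>) < \<infinity>" using U by blast
qed

lemma gradient_ge_increment:
  assumes ab: "a \<le> b" and sub: "{a<..<b} \<subseteq> N_set p w"
  shows "ennreal \<bar>f b - f a\<bar> \<le> (\<integral>\<^sup>+x\<in>{a..b}. gradient x \<partial>lborel)"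
proof -
  have "ennreal \<bar>f b - f a\<bar> \<le> (\<integral>\<^sup>+x\<in>{a..b}. ennreal \<bar>deriv f x\<bar> \<partial>lborel)"
    by (rule lipschitz_increment_le_integral_deriv[OF lip ab])
  also have "\<dots> = (\<integral>\<^sup>+x\<in>{a..b}. gradient x \<partial>lborel)"
  proof (rule nn_integral_cong_AE)
    have "AE x in lborel. x \<notin> B" using B_null by (rule AE_not_in)
    moreover have "AE x in lborel. x \<noteq> a" "AE x in lborel. x \<noteq> b" by (rule AE_lborel_singleton)+
    ultimately show "AE x in lborel. ennreal \<bar>deriv f x\<bar> * indicator {a..b} x = gradient x * indicator {a..b} x"
    proof eventually_elim
      case (elim x)
      show ?case
      proof (cases "x \<in> {a..b}")
        case True
        then have "x \<in> N_set p w" using sub elim by auto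
        moreover have "deriv f x = D x" using elim by (intro DERIV_imp_deriv D)
        ultimately show ?thesis using elim by (simp add: gradient_def)
      qed simp
    qed
  qed
  finally show ?thesis .
qed

text \<open>If the inequality fails on a curve between \<open>s\<close> and \<open>t\<close>, then \<open>gradient_ge_increment\<close> shows that some point
  strictly between \<open>s\<close> and \<open>t\<close> is outside \<open>N_set p w\<close>. A rational interval around this point, within \<open>(s, t)\<close>, has
  infinite dual weight, so the curve belongs to one of countably many null families.\<close>
lemma gradient_upper: "p_upper_gradient p \<mu> f gradient"
proof -
  define I where "I = {(u, v). u \<in> \<rat> \<and> v \<in> \<rat> \<and> u < v \<and> (\<integral>\<^sup>+x\<in>{u<..<v}. dual_weight p w x \<partial>lborel) = \<infinity>}"
  have "I \<subseteq> \<rat> \<times> \<rat>" by (auto simp: I_def)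
  then have I: "countable I" by (rule countable_subset) (intro countable_SIGMA countable_rat)
  define bad where "bad = {c \<in> ac_curves. \<not> (case c of (a, b, \<gamma>) \<Rightarrow> 
      ennreal \<bar>f (\<gamma> b) - f (\<gamma> a)\<bar> \<le> curve_integral gradient (a, b, \<gamma>))}"
  have "bad \<subseteq> (\<Union>i\<in>I. case_prod crossing i)"
  proof
    fix c assume c: "c \<in> bad"
    obtain a b \<gamma> where c_eq: "c = (a, b, \<gamma>)" by (cases c)
    then have ab: "a \<le> b" "absolutely_continuous_curve_on a b \<gamma>"
      and not_le: "\<not> ennreal \<bar>f (\<gamma> b) - f (\<gamma> a)\<bar> \<le> curve_integral gradient (a, b, \<gamma>)"
      using c by (auto simp: bad_def ac_curves_def)
    define s where "s = min (\<gamma> a) (\<gamma> b)"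
    define t where "t = max (\<gamma> a) (\<gamma> b)"
    have "\<not> {s<..<t} \<subseteq> N_set p w"
    proof
      assume "{s<..<t} \<subseteq> N_set p w"
      then have "ennreal \<bar>f t - f s\<bar> \<le> (\<integral>\<^sup>+x\<in>{s..t}. gradient x \<partial>lborel)"
        by (intro gradient_ge_increment) (auto simp: s_def t_def)
      also have "\<dots> \<le> curve_integral gradient (a, b, \<gamma>)"
        unfolding s_def t_def by (intro curve_integral_ge ab gradient_borel)
      also have "\<bar>f t - f s\<bar> = \<bar>f (\<gamma> b) - f (\<gamma> a)\<bar>"
        by (auto simp: s_def t_def min_def max_def abs_minus_commute)
      finally show False using not_le by simp
    qed
    then obtain x where x: "s < x" "x < t" "x \<notin> N_set p w"
      unfolding subset_eq by auto
    obtain u v where uv: "u \<in> \<rat>" "v \<in> \<rat>" "u < x" "x < v" "{u..v} \<subseteq> {s<..<t}"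
      by (rule open_contains_rational_interval[of "{s<..<t}" x]) (use x in auto)
    have "(\<integral>\<^sup>+x\<in>{u<..<v}. dual_weight p w x \<partial>lborel) = \<infinity>"
    proof (rule ccontr)
      assume "\<not> ?thesis"
      then have "(\<integral>\<^sup>+x\<in>{u<..<v}. dual_weight p w x \<partial>lborel) < \<infinity>" by (simp add: less_top)
      then have "x \<in> N_set p w" unfolding N_set_def using uv by (auto intro!: exI[of _ "{u<..<v}"])
      then show False using x by simp
    qed
    then have "(u, v) \<in> I" using uv by (auto simp: I_def)
    moreover have "c \<in> crossing u v"
    proof -
      have "{u<..<v} \<subseteq> {u..v}" "{s<..<t} \<subseteq> {s..t}" by auto
      then have "{u<..<v} \<subseteq> {s..t}" using uv(5) by blast
      then show ?thesis using ab by (simp add: crossing_def c_eq ac_curves_def s_def t_def)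
    qed
    ultimately show "c \<in> (\<Union>i\<in>I. case_prod crossing i)" by blast
  qed
  moreover have "Modulus p \<mu> (\<Union>i\<in>I. case_prod crossing i) = 0"
    using p by (intro Modulus_null_UN sets_\<mu> I) (auto simp: I_def intro!: Modulus_crossing_null)
  ultimately have "Modulus p \<mu> bad = 0"
    using Modulus_mono[of bad "\<Union>i\<in>I. case_prod crossing i" p \<mu>] by simp
  then show ?thesis
    unfolding p_upper_gradient_def AE_curve_def bad_def by simp
qed

text \<open>Off \<open>B\<close> the measure \<open>\<mu>\<close> is absolutely continuous, so only the behaviour on \<open>B\<close> has to be checked separately.\<close>
lemma AE_lborel_imp_AE_\<mu>:
  assumes "AE x in lborel. P x" and [measurable]: "Measurable.pred borel P" and B: "\<And>x. x \<in> B \<Longrightarrow> P x"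
  shows "AE x in \<mu>. P x"
proof -
  define A where "A = {x. \<not> P x}"
  have [measurable]: "A \<in> sets borel" by (simp add: A_def)
  have "emeasure \<mu> A = (\<integral>\<^sup>+x. indicator A x \<partial>\<mu>)" using sets_\<mu> by simp
  also have "\<dots> = (\<integral>\<^sup>+x. indicator A x * ennreal (w x) \<partial>lborel)"
    using B by (intro weight_eq) (auto simp: A_def)
  also have "\<dots> = (\<integral>\<^sup>+x. 0 \<partial>(lborel::real measure))"
    by (rule nn_integral_cong_AE) (use assms(1) in \<open>auto simp: A_def elim!: eventually_mono\<close>)
  finally have "A \<in> null_sets \<mu>" using sets_\<mu> by (simp add: null_sets_def)
  then show ?thesis by (rule AE_I') (auto simp: A_def)
qed

text \<open>A single segment of positive modulus cannot be exceptional.\<close>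
lemma upper_gradient_on_segment:
  assumes g: "p_upper_gradient p \<mu> f g" and uv: "u < v"
    and fin: "(\<integral>\<^sup>+x\<in>{u..v}. dual_weight p w x \<partial>lborel) < \<infinity>"
  shows "ennreal \<bar>f v - f u\<bar> \<le> (\<integral>\<^sup>+x\<in>{u..v}. g x \<partial>lborel)"
proof (rule ccontr)
  assume not_le: "\<not> ?thesis"
  let ?bad = "{c \<in> ac_curves. \<not> (case c of (a, b, \<gamma>) \<Rightarrow> 
      ennreal \<bar>f (\<gamma> b) - f (\<gamma> a)\<bar> \<le> curve_integral g (a, b, \<gamma>))}"
  have "absolutely_continuous_curve_on u v (\<lambda>x. x)"
    by (rule lipschitz_absolutely_continuous[of 1]) (auto simp: lipschitz_on_def)
  then have "{(u, v, \<lambda>x. x)} \<subseteq> ?bad"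
    using not_le uv by (auto simp: ac_curves_def)
  then have "Modulus p \<mu> {(u, v, \<lambda>x. x)} \<le> Modulus p \<mu> ?bad" by (rule Modulus_mono)
  also have "\<dots> = 0" using g by (simp add: p_upper_gradient_def AE_curve_def)
  finally show False using Modulus_segment_pos[OF uv fin] by simp
qed

text \<open>Local integrability of \<open>epowr g p\<close> and of the dual weight makes \<open>g\<close> Lebesgue integrable on short
  rational intervals in \<open>N_set p w\<close>, by Young's inequality. There the differentiation theorem applies;
  elsewhere \<open>gradient\<close> is zero.\<close>
lemma gradient_minimal:
  assumes g: "p_upper_gradient p \<mu> f g" and int: "locally_p_integrable p \<mu> g"
  shows "AE x in \<mu>. gradient x \<le> g x"
proof -
  have g_borel [measurable]: "g \<in> borel_measurable borel" using g by (simp add: p_upper_gradient_def)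
  have derivAE: "AE x in lborel. (f has_real_derivative D x) (at x)"
    using AE_not_in[OF B_null] by eventually_elim (rule D)
  define I where "I = {(u, v). u \<in> \<rat> \<and> v \<in> \<rat> \<and> (\<integral>\<^sup>+x\<in>{u..v}. dual_weight p w x \<partial>lborel) < \<infinity> \<and>
      (\<integral>\<^sup>+x\<in>{u..v}. epowr (g x) p \<partial>\<mu>) < \<infinity>}"
  have "I \<subseteq> \<rat> \<times> \<rat>" by (auto simp: I_def)
  then have I: "countable I" by (rule countable_subset) (intro countable_SIGMA countable_rat)
  have loc: "AE x in lborel. x \<in> {fst i<..<snd i} \<longrightarrow> ennreal \<bar>D x\<bar> \<le> g x" if i: "i \<in> I" for i
  proof -
    obtain u v where uv: "i = (u, v)" "(\<integral>\<^sup>+x\<in>{u..v}. dual_weight p w x \<partial>lborel) < \<infinity>"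
      "(\<integral>\<^sup>+x\<in>{u..v}. epowr (g x) p \<partial>\<mu>) < \<infinity>" using i by (auto simp: I_def)
    have mono: "(\<integral>\<^sup>+x\<in>A. h x \<partial>M) \<le> (\<integral>\<^sup>+x\<in>A'. h x \<partial>M)" if "A \<subseteq> A'" for A A' h and M :: "real measure"
      using that by (intro nn_integral_mono mult_left_mono) (auto simp: indicator_def)
    have "AE x in lborel. x \<in> {u<..<v} \<longrightarrow> ennreal \<bar>D x\<bar> \<le> g x"
    proof (rule derivative_le_of_increment_le_integral[OF _ g_borel D_borel _ _ derivAE])
      have "(\<integral>\<^sup>+x\<in>{u<..<v}. g x \<partial>lborel) \<le> (\<integral>\<^sup>+x\<in>{u..v}. g x \<partial>lborel)"
        by (rule mono) auto
      also have "\<dots> \<le> (\<integral>\<^sup>+x\<in>{u..v}. dual_weight p w x \<partial>lborel) + (\<integral>\<^sup>+x\<in>{u..v}. epowr (g x) p \<partial>\<mu>)"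
        using integral_Young[of g "{u..v}" 1] by simp
      also have "\<dots> < \<infinity>" using uv by simp
      finally show "(\<integral>\<^sup>+x\<in>{u<..<v}. g x \<partial>lborel) < \<infinity>" .
      fix s t assume st: "s < t" "{s..t} \<subseteq> {u<..<v}"
      then have "{s..t} \<subseteq> {u..v}" using greaterThanLessThan_subseteq_atLeastAtMost_iff[of u v u v] by blast
      then have "(\<integral>\<^sup>+x\<in>{s..t}. dual_weight p w x \<partial>lborel) < \<infinity>"
        using mono[of "{s..t}" "{u..v}"] uv(2) by (meson le_less_trans)
      then show "ennreal \<bar>f t - f s\<bar> \<le> (\<integral>\<^sup>+x\<in>{s..t}. g x \<partial>lborel)"
        by (rule upper_gradient_on_segment[OF g st(1)])
    qed auto
    then show ?thesis by (simp add: uv(1))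
  qed
  have "AE x in lborel. \<forall>i\<in>I. x \<in> {fst i<..<snd i} \<longrightarrow> ennreal \<bar>D x\<bar> \<le> g x"
    using loc by (subst AE_ball_countable[OF I]) auto
  then have "AE x in lborel. gradient x \<le> g x"
  proof eventually_elim
    case (elim x)
    show ?case
    proof (cases "x \<in> N_set p w")
      case True
      then obtain U where U: "open U" "x \<in> U" "(\<integral>\<^sup>+y\<in>U. dual_weight p w y \<partial>lborel) < \<infinity>"
        by (auto simp: N_set_def)
      obtain V where V: "open V" "x \<in> V" "(\<integral>\<^sup>+y\<in>V. epowr (g y) p \<partial>\<mu>) < \<infinity>"
        using int by (auto simp: locally_p_integrable_def)
      obtain u v where uv: "u \<in> \<rat>" "v \<in> \<rat>" "u < x" "x < v" "{u..v} \<subseteq> U \<inter> V"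
        by (rule open_contains_rational_interval[of "U \<inter> V" x]) (use U V in auto)
      have "(\<integral>\<^sup>+x\<in>{u..v}. dual_weight p w x \<partial>lborel) \<le> (\<integral>\<^sup>+y\<in>U. dual_weight p w y \<partial>lborel)"
        using uv(5) by (intro nn_integral_mono mult_left_mono) (auto simp: indicator_def)
      moreover have "(\<integral>\<^sup>+x\<in>{u..v}. epowr (g x) p \<partial>\<mu>) \<le> (\<integral>\<^sup>+y\<in>V. epowr (g y) p \<partial>\<mu>)"
        using uv(5) by (intro nn_integral_mono mult_left_mono) (auto simp: indicator_def)
      ultimately have "(u, v) \<in> I" using uv U V by (auto simp: I_def intro: le_less_trans)
      then have "ennreal \<bar>D x\<bar> \<le> g x" using elim uv by force
      then show ?thesis by (simp add: gradient_def)
    qed (simp add: gradient_def)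
  qed
  then show ?thesis
    by (rule AE_lborel_imp_AE_\<mu>) (auto simp: gradient_def)
qed

theorem gradient_p_weak_gradient: "p_weak_gradient p \<mu> f gradient"
  unfolding p_weak_gradient_def
  using gradient_upper gradient_locally_integrable gradient_minimal by blast

end

lemma Lebesgue_decomposition_integrals:
  fixes \<mu> \<mu>s :: "real measure" and w :: "real \<Rightarrow> real" and h :: "real \<Rightarrow> ennreal"
  assumes \<mu>: "sets \<mu> = sets borel" and \<mu>s: "sets \<mu>s = sets borel"
    and w[measurable]: "w \<in> borel_measurable borel"
    and dec: "\<And>A. A \<in> sets borel \<Longrightarrow>
           emeasure \<mu> A = emeasure (density lborel (\<lambda>x. ennreal (w x))) A + emeasure \<mu>s A"
    and B[measurable]: "B \<in> sets borel" and conc: "AE x in \<mu>s. x \<in> B"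
    and h[measurable]: "h \<in> borel_measurable borel"
  shows "(\<integral>\<^sup>+x. h x * ennreal (w x) \<partial>lborel) \<le> (\<integral>\<^sup>+x. h x \<partial>\<mu>)"
    and "(\<And>x. x \<in> B \<Longrightarrow> h x = 0) \<Longrightarrow> (\<integral>\<^sup>+x. h x \<partial>\<mu>) = (\<integral>\<^sup>+x. h x * ennreal (w x) \<partial>lborel)"
proof -
  note [measurable_cong] = \<mu> \<mu>s
  let ?a = "density lborel (\<lambda>x. ennreal (w x))"
  have "?a \<le> \<mu>" using \<mu> dec by (subst le_measure) auto
  then have "(\<integral>\<^sup>+x. h x \<partial>?a) \<le> (\<integral>\<^sup>+x. h x \<partial>\<mu>)" using \<mu> by (intro nn_integral_mono_measure) auto
  then show "(\<integral>\<^sup>+x. h x * ennreal (w x) \<partial>lborel) \<le> (\<integral>\<^sup>+x. h x \<partial>\<mu>)"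
    by (simp add: nn_integral_density mult.commute)
  assume h0: "\<And>x. x \<in> B \<Longrightarrow> h x = 0"
  have eq: "density \<mu> (indicator (- B)) = density ?a (indicator (- B))"
  proof (rule measure_eqI)
    fix A assume "A \<in> sets (density \<mu> (indicator (- B)))"
    then have [measurable]: "A \<in> sets borel" using \<mu> by simp
    have "AE x in \<mu>s. x \<notin> A - B" using conc by eventually_elim auto
    then have "emeasure \<mu>s (A - B) = 0"
      using \<mu>s by (subst (asm) AE_iff_null_sets[symmetric]) auto
    then have "emeasure \<mu> (A - B) = emeasure ?a (A - B)" using dec[of "A - B"] by simp
    moreover have "emeasure (density M (indicator (- B))) A = emeasure M (A - B)" if "sets M = sets borel" for M
    proof -
      have [measurable_cong]: "sets M = sets borel" by (rule that)
      have ind: "indicator (- B) x * indicator A x = (indicator (A - B) x :: ennreal)" for x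
        by (auto split: split_indicator)
      have "emeasure (density M (indicator (- B))) A = (\<integral>\<^sup>+x. indicator (A - B) x \<partial>M)"
        unfolding ind[symmetric] by (rule emeasure_density) (auto simp: that)
      then show ?thesis using that by simp
    qed
    ultimately show "emeasure (density \<mu> (indicator (- B))) A = emeasure (density ?a (indicator (- B))) A"
      using \<mu> by simp
  qed (use \<mu> in auto)
  have ind: "indicator (- B) x * h x = h x" for x using h0[of x] by (cases "x \<in> B") auto
  have "(\<integral>\<^sup>+x. h x \<partial>\<mu>) = (\<integral>\<^sup>+x. h x \<partial>density \<mu> (indicator (- B)))"
    by (subst nn_integral_density) (auto simp: ind)
  also have "\<dots> = (\<integral>\<^sup>+x. h x \<partial>density ?a (indicator (- B)))" by (simp add: eq)
  also have "\<dots> = (\<integral>\<^sup>+x. h x \<partial>?a)"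
    by (subst nn_integral_density) (auto simp: ind)
  also have "\<dots> = (\<integral>\<^sup>+x. h x * ennreal (w x) \<partial>lborel)"
    by (simp add: nn_integral_density mult.commute)
  finally show "(\<integral>\<^sup>+x. h x \<partial>\<mu>) = (\<integral>\<^sup>+x. h x * ennreal (w x) \<partial>lborel)" .
qed

text \<open>\<open>B\<close> is a Borel null set that contains \<open>N\<close> and the points where \<open>f\<close> is not differentiable. The function
  \<open>gradient\<close> and \<open>df_abs\<close> agree except possibly on \<open>B - N\<close>, which is \<open>\<mu>\<close>-negligible: Lebesgue null for the
  absolutely continuous part, disjoint from \<open>N\<close> for the singular part.\<close>
theorem theorem2:
  fixes p :: real and \<mu> \<mu>\<^sub>s :: "real measure" and f\<^sub>a f :: "real \<Rightarrow> real" and N :: "real set"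
  assumes "p > 1"
    and "sets \<mu> = sets borel" and "locally_finite_measure \<mu>"
    and "f\<^sub>a \<in> borel_measurable borel" and "\<And>x. 0 \<le> f\<^sub>a x"
    and "sets \<mu>\<^sub>s = sets borel"
    and "\<And>A. A \<in> sets borel \<Longrightarrow>
           emeasure \<mu> A = emeasure (density lborel (\<lambda>x. ennreal (f\<^sub>a x))) A + emeasure \<mu>\<^sub>s A"
    and "N \<in> null_sets lebesgue" and "AE x in \<mu>\<^sub>s. x \<in> N"
    and "\<exists>L. L-lipschitz_on UNIV f"
  shows "(\<exists>G. p_weak_gradient p \<mu> f G) \<and>
         (\<forall>G. p_weak_gradient p \<mu> f G \<longrightarrow>
            (AE x in \<mu>. G x = ennreal (df_abs p f\<^sub>a N f x)))"
proof -
  obtain L where lip: "L-lipschitz_on UNIV f" using assms(10) by blast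
  have "negligible {x. \<not> f differentiable (at x)}"
  proof (rule negligible_subset)
    show "negligible (\<Union>n::nat. {x \<in> {- real n<..<real n}. \<not> f differentiable (at x)})"
      by (intro negligible_countable_Union)
         (auto intro!: absolutely_continuous_differentiable lipschitz_absolutely_continuous[OF lip] simp del: greaterThanLessThan_iff)
    have "\<exists>n::nat. x \<in> {- real n<..<real n}" for x :: real
      using reals_Archimedean2[of "\<bar>x\<bar>"] by (simp add: abs_less_iff minus_less_iff conj_commute)
    then show "{x. \<not> f differentiable (at x)} \<subseteq> (\<Union>n::nat. {x \<in> {- real n<..<real n}. \<not> f differentiable (at x)})"
      by blast
  qed
  moreover have "negligible N" using assms(8) by (simp add: negligible_iff_null_sets)
  ultimately have "negligible ({x. \<not> f differentiable (at x)} \<union> N)" by (rule negligible_Un)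
  then obtain B where B: "B \<in> null_sets lborel" "{x. \<not> f differentiable (at x)} \<union> N \<subseteq> B"
    by (rule negligible_borel_hull)
  then have [measurable]: "B \<in> sets borel" by auto
  define D where "D = right_quotient_lim f"
  have D: "(f has_real_derivative D x) (at x)" if "x \<notin> B" for x
  proof -
    have "f differentiable (at x)" using that B by auto
    then obtain d where "(f has_real_derivative d) (at x)" by (auto simp: real_differentiable_def)
    then show ?thesis using right_quotient_lim_eq by (simp add: D_def)
  qed
  have f_borel: "f \<in> borel_measurable borel"
    using lipschitz_on_continuous_on[OF lip] by (rule borel_measurable_continuous_onI)
  have conc: "AE x in \<mu>\<^sub>s. x \<in> B" using assms(9) by eventually_elim (use B in auto)
  interpret weighted_line_lipschitz p \<mu> f\<^sub>a B f D L
  proof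
    show "D \<in> borel_measurable borel" unfolding D_def using f_borel by (rule right_quotient_lim_borel)
  qed (use assms B D lip Lebesgue_decomposition_integrals[OF assms(2,6,4,7) _ conc] in auto)
  have grad: "p_weak_gradient p \<mu> f gradient" by (rule gradient_p_weak_gradient)
  have "AE x in \<mu>. gradient x = ennreal (df_abs p f\<^sub>a N f x)"
  proof -
    \<comment> \<open>\<open>N\<close> need not be a Borel set, so its complement is enclosed in a measurable null set \<open>S\<close>.\<close>
    obtain S where S: "{x \<in> space \<mu>\<^sub>s. x \<notin> N} \<subseteq> S" "emeasure \<mu>\<^sub>s S = 0" "S \<in> sets \<mu>\<^sub>s"
      using AE_E[OF assms(9)] by blast
    have [measurable]: "S \<in> sets borel" using S assms(6) by simp
    have "emeasure (density lborel (\<lambda>x. ennreal (f\<^sub>a x))) (B \<inter> S) = 0"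
    proof -
      have "absolutely_continuous lborel (density lborel (\<lambda>x. ennreal (f\<^sub>a x)))"
        using assms(4) by (intro absolutely_continuousI_density) auto
      moreover have "B \<inter> S \<in> null_sets lborel" using B by (intro null_set_Int2) auto
      ultimately show ?thesis by (auto simp: absolutely_continuous_def)
    qed
    moreover have "emeasure \<mu>\<^sub>s (B \<inter> S) = 0"
      using emeasure_mono[of "B \<inter> S" S \<mu>\<^sub>s] S by simp
    ultimately have "B \<inter> S \<in> null_sets \<mu>" using assms(2) assms(7)[of "B \<inter> S"] by (simp add: null_sets_def)
    then have "AE x in \<mu>. x \<notin> B \<inter> S" by (rule AE_not_in)
    then show ?thesis
    proof eventually_elim
      case (elim x)
      have "space \<mu>\<^sub>s = UNIV" using sets_eq_imp_space_eq[OF assms(6)] by simp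
      then have xN: "x \<in> N" if "x \<in> B" using elim S(1) that by auto
      show ?case
      proof (cases "x \<in> B")
        case True
        then show ?thesis using xN by (simp add: gradient_def df_abs_def)
      next
        case False
        then have "x \<notin> N" "deriv f x = D x" using B D by (auto intro: DERIV_imp_deriv)
        then show ?thesis using False by (simp add: gradient_def df_abs_def)
      qed
    qed
  qed
  then have "AE x in \<mu>. G x = ennreal (df_abs p f\<^sub>a N f x)" if "p_weak_gradient p \<mu> f G" for G
    using p_weak_gradient_unique[OF that grad] by eventually_elim simp
  then show ?thesis using grad by blast
qed

end
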